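(* The function $d_\tau$ is a metric on $\mathcal D$, and for all $X,Y\in\mathcal D$ the infimum over couplings $\pi\in\mathcal T(\mu_X,\mu_Y)$ in the definition of $d_\tau(X,Y)$ is attained.
   Context: A geometric data set is a triple $(X,F_X,\mu_X)$ where $F_X$ is a nonempty family of real-valued functions (features) on $X$ such that $d_X(x,x'):=\sup_{f\in F_X}|f(x)-f(x')|$ is a (finite) complete separable metric on $X$, and $\mu_X$ is a Borel probability measure on $(X,d_X)$ with full support. $\overline{F_X}$ denotes the closure of $F_X$ in the set of real-valued functions on $X$ under pointwise convergence. $X$ and $Y$ are isomorphic if there is a Borel map $\phi:X\to Y$ with $\phi_*\mu_X=\mu_Y$ and $\overline{F_Y}\circ\phi=\overline{F_X}$. Isomorphic geometric data sets are identified; $\mathcal D$ is the set of isomorphism classes. $\mathcal T(\mu,\nu)$ is the set of couplings of $\mu,\nu$ (Borel probability measures on the product with marginals $\mu,\nu$); $\mathrm{pr}_1,\mathrm{pr}_2$ are the coordinate projections; $(d)_H$ is the Hausdorff distance induced by $d$. Compactified observable distance. $\tau:\mathbb R\to(-1/2,1/2)$, $\tau(r)=\frac12\tanh r$. $\mathsf K_\tau(X)$ is the closure of $\{\tau\circ f\mid f\in F_X\}$ under pointwise convergence on $X$. With $d_{1,\pi}(u,v)=\int|u-v|\,d\pi$, set \[D_\tau^\pi(X,Y):=(d_{1,\pi})_H(\mathsf K_\tau(X)\circ\mathrm{pr}_1,\mathsf K_\tau(Y)\circ\mathrm{pr}_2)\quad(\pi\in\mathcal T(\mu_X,\mu_Y)),\qquad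 d_\tau(X,Y):=\inf_{\pi\in\mathcal T(\mu_X,\mu_Y)}D^\pi_\tau(X,Y).\] *)

theory Defs
  imports "HOL-Probability.Probability"
begin

record 'a geom_data =
  points :: "'a set"
  features :: "('a \<Rightarrow> real) set"
  prob_meas :: "'a measure"

definition feature_dist :: "'a geom_data \<Rightarrow> 'a \<Rightarrow> 'a \<Rightarrow> real" where
  "feature_dist X x x' =
     (if x \<in> points X \<and> x' \<in> points X then (SUP f\<in>features X. \<bar>f x - f x'\<bar>) else 0)"

abbreviation data_topology :: "'a geom_data \<Rightarrow> 'a topology" where
  "data_topology X \<equiv> Metric_space.mtopology (points X) (feature_dist X)"

definition borel_sets :: "'a topology \<Rightarrow> 'a set set" where
  "borel_sets T = sigma_sets (topspace T) {U. openin T U}"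

text \<open>
  A real-valued function on a carrier \<open>S\<close> is represented by an element of
  \<open>S \<rightarrow>\<^sub>E UNIV\<close>, so that \<^term>\<open>powertop_real S\<close> is the space of all real-valued functions
  on \<open>S\<close> with the topology of pointwise convergence.  Since \<^const>\<open>Sup\<close> on \<^typ>\<open>real\<close> is total,
  finiteness of \<^const>\<open>feature_dist\<close> is the separate \<^const>\<open>bdd_above\<close> condition.
\<close>

definition geometric_data_set :: "'a geom_data \<Rightarrow> bool" where
  "geometric_data_set X \<longleftrightarrow>
     features X \<noteq> {} \<and>
     features X \<subseteq> points X \<rightarrow>\<^sub>E UNIV \<and>
     (\<forall>x\<in>points X. \<forall>x'\<in>points X. bdd_above ((\<lambda>f. \<bar>f x - f x'\<bar>) ` features X)) \<and>
     Metric_space (points X) (feature_dist X) \<and>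
     Metric_space.mcomplete (points X) (feature_dist X) \<and>
     separable_space (data_topology X) \<and>
     prob_space (prob_meas X) \<and>
     space (prob_meas X) = points X \<and>
     sets (prob_meas X) = borel_sets (data_topology X) \<and>
     (\<forall>x\<in>points X. \<forall>U. openin (data_topology X) U \<and> x \<in> U \<longrightarrow> 0 < measure (prob_meas X) U)"

definition features_closure :: "'a geom_data \<Rightarrow> ('a \<Rightarrow> real) set" where
  "features_closure X = powertop_real (points X) closure_of features X"

definition isomorphic_data :: "'a geom_data \<Rightarrow> 'b geom_data \<Rightarrow> bool" where
  "isomorphic_data X Y \<longleftrightarrow>
     (\<exists>\<phi> \<in> prob_meas X \<rightarrow>\<^sub>M prob_meas Y.
        distr (prob_meas X) (prob_meas Y) \<phi> = prob_meas Y \<and>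
        (\<lambda>g. compose (points X) g \<phi>) ` features_closure Y = features_closure X)"

definition couplings :: "'a geom_data \<Rightarrow> 'b geom_data \<Rightarrow> ('a \<times> 'b) measure set" where
  "couplings X Y =
     {\<pi>. prob_space \<pi> \<and>
         space \<pi> = points X \<times> points Y \<and>
         sets \<pi> = borel_sets (prod_topology (data_topology X) (data_topology Y)) \<and>
         distr \<pi> (prob_meas X) fst = prob_meas X \<and>
         distr \<pi> (prob_meas Y) snd = prob_meas Y}"

text \<open>
  The value is meaningful for nonempty \<open>A\<close>, \<open>B\<close> on which \<open>d\<close> is nonnegative and bounded; below,
  \<open>d\<close> is bounded by 1.
\<close>

definition hausdorff_dist :: "('a \<Rightarrow> 'a \<Rightarrow> real) \<Rightarrow> 'a set \<Rightarrow> 'a set \<Rightarrow> real" where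
  "hausdorff_dist d A B = max (SUP a\<in>A. INF b\<in>B. d a b) (SUP b\<in>B. INF a\<in>A. d a b)"

definition tau :: "real \<Rightarrow> real" where
  "tau r = tanh r / 2"

definition K_tau :: "'a geom_data \<Rightarrow> ('a \<Rightarrow> real) set" where
  "K_tau X = powertop_real (points X) closure_of ((\<lambda>f. compose (points X) tau f) ` features X)"

definition L1_dist :: "'a measure \<Rightarrow> ('a \<Rightarrow> real) \<Rightarrow> ('a \<Rightarrow> real) \<Rightarrow> real" where
  "L1_dist \<pi> u v = (\<integral>p. \<bar>u p - v p\<bar> \<partial>\<pi>)"

definition D_tau :: "('a \<times> 'b) measure \<Rightarrow> 'a geom_data \<Rightarrow> 'b geom_data \<Rightarrow> real" where
  "D_tau \<pi> X Y =
     hausdorff_dist (L1_dist \<pi>)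
       ((\<lambda>u. compose (points X \<times> points Y) u fst) ` K_tau X)
       ((\<lambda>v. compose (points X \<times> points Y) v snd) ` K_tau Y)"

definition d_tau :: "'a geom_data \<Rightarrow> 'b geom_data \<Rightarrow> real" where
  "d_tau X Y = (INF \<pi>\<in>couplings X Y. D_tau \<pi> X Y)"

definition iso_rel :: "('a geom_data \<times> 'a geom_data) set" where
  "iso_rel = {(X, Y). geometric_data_set X \<and> geometric_data_set Y \<and> isomorphic_data X Y}"

text \<open>
  Isomorphism classes of the geometric data sets whose points are drawn from the type \<^typ>\<open>'a\<close>.
  A complete separable metric space has at most continuum many points, so that taking \<^typ>\<open>real\<close>
  for \<^typ>\<open>'a\<close> yields all isomorphism classes.
\<close>

definition data_classes :: "'a geom_data set set" where
  "data_classes = Collect geometric_data_set // iso_rel"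

text \<open>\<^const>\<open>Metric_space\<close> asks for symmetry and nonnegativity also off the carrier, hence the 0.\<close>

definition class_d_tau :: "'a geom_data set \<Rightarrow> 'a geom_data set \<Rightarrow> real" where
  "class_d_tau C C' =
     (if C \<in> data_classes \<and> C' \<in> data_classes
      then d_tau (SOME X. X \<in> C) (SOME Y. Y \<in> C') else 0)"

end

theory Submission
  imports Defs
begin

text \<open>
  Elements of \<open>K\<^sub>\<tau>\<close> are 1-Lipschitz with values in \<open>[-1/2, 1/2]\<close>, so that they are controlled in
  \<open>L\<^sup>1\<close> by their values at finitely many points.

  Triangle inequality: couplings are glued approximately, along a partition of the middle space
  into countably many small cells. Attainment: by Tychonoff's theorem a minimizing sequence of
  couplings has a setwise cluster point, which is finitely additive with the right marginals;
  since the marginals are tight, Caratheodory's theorem turns it into a coupling, and costs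
  converge because they are uniform limits of combinations of measures of rectangles.
  If \<open>d\<^sub>\<tau> X Y = 0\<close>, the support of an optimal coupling is the graph of an isometry that matches
  the features.
\<close>

section \<open>Pointwise closures and data sets\<close>

text \<open>The obstacle is that \<open>D_tau\<close> quantifies over infinite sets of functions,
  whereas a cluster point of couplings controls one pair of functions at a time. The common
  Lipschitz bound makes \<open>K_tau\<close> totally bounded in mean, so that a finite net replaces
  all competitors; as all couplings have the same marginals, the replacement error does not depend
  on the coupling. Pointwise closures consist of limits of nets, to which dominated convergence does
  not apply; hence they enter integrals only through values at finitely many points. Separation
  needs attainment: near-optimal couplings alone provide no single support on which features could
  be matched. Symmetry and transitivity of isomorphism are not evident from a Borel map in one
  direction; they follow from symmetry and the triangle inequality of \<open>d_tau\<close> once its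
  zeros are known. Hence \<open>d_tau\<close> is studied on data sets first, and isomorphism classes
  come last.\<close>

lemma in_closure_of_powertop_real:
  assumes F: "F \<subseteq> S \<rightarrow>\<^sub>E UNIV"
  shows "f \<in> powertop_real S closure_of F \<longleftrightarrow>
    f \<in> S \<rightarrow>\<^sub>E UNIV \<and>
    (\<forall>A e. finite A \<longrightarrow> A \<subseteq> S \<longrightarrow> 0 < e \<longrightarrow> (\<exists>g\<in>F. \<forall>a\<in>A. \<bar>f a - g a\<bar> < e))"
    (is "_ \<longleftrightarrow> _ \<and> ?R")
proof (cases "f \<in> S \<rightarrow>\<^sub>E UNIV")
  case True
  have "(\<forall>T. f \<in> T \<and> openin (powertop_real S) T \<longrightarrow> (\<exists>g. g \<in> F \<and> g \<in> T)) \<longleftrightarrow> ?R"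
  proof (intro iffI allI impI)
    fix A and e :: real
    assume *: "\<forall>T. f \<in> T \<and> openin (powertop_real S) T \<longrightarrow> (\<exists>g. g \<in> F \<and> g \<in> T)"
      and A: "finite A" "A \<subseteq> S" and e: "0 < e"
    define T where "T = PiE S (\<lambda>i. if i \<in> A then ball (f i) e else UNIV)"
    have "openin (powertop_real S) T"
      unfolding T_def openin_PiE_gen
      by (rule disjI2, intro conjI)
         (auto intro: finite_subset[OF _ A(1)] simp: if_distrib)
    moreover have "f \<in> T"
      using True e by (auto simp: T_def)
    ultimately obtain g where "g \<in> F" "g \<in> T"
      using * by blast
    with A show "\<exists>g\<in>F. \<forall>a\<in>A. \<bar>f a - g a\<bar> < e"
      by (intro bexI[of _ g]) (force simp: T_def PiE_def Pi_def dist_real_def)+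
  next
    fix T assume R: ?R and T: "f \<in> T \<and> openin (powertop_real S) T"
    then obtain U where U: "finite {i \<in> S. U i \<noteq> UNIV}" "\<And>i. i \<in> S \<Longrightarrow> open (U i)"
        "f \<in> PiE S U" "PiE S U \<subseteq> T"
      unfolding openin_product_topology_alt by force
    define A where "A = {i \<in> S. U i \<noteq> UNIV}"
    have "\<forall>i\<in>A. \<exists>r>0. ball (f i) r \<subseteq> U i"
      using U(2,3) by (auto simp: A_def open_contains_ball)
    then obtain r where r: "\<And>i. i \<in> A \<Longrightarrow> r i > 0" "\<And>i. i \<in> A \<Longrightarrow> ball (f i) (r i) \<subseteq> U i"
      by metis
    \<comment> \<open>The \<open>insert 1\<close> keeps the minimum meaningful when no coordinate is
      constrained.\<close>
    define e where "e = Min (insert 1 (r ` A))"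
    have fin: "finite A" and "A \<subseteq> S"
      using U(1) by (auto simp: A_def)
    moreover have "e > 0"
      using fin r by (auto simp: e_def)
    ultimately obtain g where g: "g \<in> F" "\<forall>a\<in>A. \<bar>f a - g a\<bar> < e"
      using R by blast
    have "g i \<in> U i" if "i \<in> S" for i
    proof (cases "i \<in> A")
      case True
      then have "e \<le> r i"
        using fin by (auto simp: e_def)
      moreover have "\<bar>f i - g i\<bar> < e"
        using g True by blast
      ultimately have "g i \<in> ball (f i) (r i)"
        by (simp add: dist_real_def)
      then show ?thesis
        using r(2)[OF True] by blast
    qed (use that in \<open>auto simp: A_def\<close>)
    then have "g \<in> PiE S U"
      using g(1) F by (auto simp: PiE_def)
    then show "\<exists>g. g \<in> F \<and> g \<in> T"
      using g(1) U(4) by blast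
  qed
  then show ?thesis
    using True by (simp add: in_closure_of)
qed (auto simp: in_closure_of)

section \<open>The compactifying function\<close>

lemma strict_mono_tau: "strict_mono tau"
  unfolding strict_mono_def tau_def using tanh_real_strict_mono by auto

lemma abs_tau_less_half: "\<bar>tau r\<bar> < 1/2"
  using tanh_real_bounds[of r] by (auto simp: tau_def)

text \<open>The derivative \<open>(1 - (tanh z)\<^sup>2) / 2\<close> lies between 0 and 1. The
  constant 1 lets \<open>K_tau\<close> inherit the feature distance as its modulus of
  continuity.\<close>

lemma tau_lipschitz: "\<bar>tau a - tau b\<bar> \<le> \<bar>a - b\<bar>"
proof -
  have *: "\<bar>tau a - tau b\<bar> \<le> \<bar>a - b\<bar>" if "a < b" for a b
  proof -
    have "\<exists>z. a < z \<and> z < b \<and> tau b - tau a = (b - a) * ((1 - (tanh z)\<^sup>2) / 2)"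
      using that unfolding tau_def
      by (intro MVT2) (auto intro!: derivative_eq_intros simp: cosh_real_nonzero)
    then obtain z where z: "tau b - tau a = (b - a) * ((1 - (tanh z)\<^sup>2) / 2)"
      by auto
    have t: "0 \<le> (tanh z)\<^sup>2" "(tanh z)\<^sup>2 \<le> 1"
      using tanh_real_bounds[of z] by (auto simp: abs_square_le_1)
    then have "0 \<le> (1 - (tanh z)\<^sup>2) / 2" "(1 - (tanh z)\<^sup>2) / 2 \<le> 1"
      by (simp_all, linarith)
    with that have "0 \<le> tau b - tau a" "tau b - tau a \<le> (b - a) * 1"
      unfolding z by (intro mult_nonneg_nonneg mult_left_mono; simp)+
    then show ?thesis
      by auto
  qed
  show ?thesis
    using *[of a b] *[of b a] by (cases a b rule: linorder_cases) auto
qed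

text \<open>The modulus \<open>c\<close> depends on \<open>r\<close>, since the inverse of
  \<open>tau\<close> is continuous but not uniformly so. Returning from \<open>K_tau\<close> to
  features therefore always fixes finitely many values first.\<close>

lemma tau_inverse_continuous:
  assumes "0 < e"
  obtains c where "0 < c" "\<And>s. \<bar>tau s - tau r\<bar> < c \<Longrightarrow> \<bar>s - r\<bar> < e"
proof
  let ?c = "min (tau (r + e) - tau r) (tau r - tau (r - e))"
  show "0 < ?c"
    using assms by (auto simp: strict_mono_less[OF strict_mono_tau])
  fix s assume "\<bar>tau s - tau r\<bar> < ?c"
  then have "tau s < tau (r + e)" "tau (r - e) < tau s"
    by auto
  then show "\<bar>s - r\<bar> < e"
    by (auto simp: strict_mono_less[OF strict_mono_tau])
qed

section \<open>Borel sets of a topology\<close>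

lemma openin_borel_sets: "openin T U \<Longrightarrow> U \<in> borel_sets T"
  by (simp add: borel_sets_def sigma_sets.Basic)

lemma closedin_borel_sets:
  assumes "closedin T C" shows "C \<in> borel_sets T"
proof -
  have "topspace T - (topspace T - C) \<in> borel_sets T"
    unfolding borel_sets_def
    by (rule sigma_sets.Compl) (use assms in \<open>auto simp: closedin_def intro: sigma_sets.Basic\<close>)
  then show ?thesis
    using closedin_subset[OF assms] by (simp add: double_diff)
qed

lemma measurable_continuous_map:
  assumes f: "continuous_map T T' f"
    and M: "space M = topspace T" "sets M = borel_sets T"
    and N: "space N = topspace T'" "sets N = borel_sets T'"
  shows "f \<in> M \<rightarrow>\<^sub>M N"
proof (rule measurable_sigma_sets[where \<Omega>="topspace T'" and A="{U. openin T' U}"])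
  show "sets N = sigma_sets (topspace T') {U. openin T' U}"
    using N by (simp add: borel_sets_def)
  show "f \<in> space M \<rightarrow> topspace T'"
    using f M by (auto simp: continuous_map_def)
  show "f -` U \<inter> space M \<in> sets M" if "U \<in> {U. openin T' U}" for U
  proof -
    have "f -` U \<inter> space M = {x \<in> topspace T. f x \<in> U}"
      using M by auto
    then show ?thesis
      using f that M by (auto simp: continuous_map_def intro!: openin_borel_sets)
  qed
qed (auto dest: openin_subset)

lemma borel_measurable_continuous_map:
  assumes "continuous_map T euclideanreal f" "space M = topspace T" "sets M = borel_sets T"
  shows "f \<in> borel_measurable M"
  by (rule measurable_continuous_map[OF assms]) (auto simp: borel_sets_def borel_def)

text \<open>Continuity from above, in the form that cuts a countable exhaustion off at a finite
  stage.\<close>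

lemma (in finite_measure) decseq_measure_less:
  assumes "\<And>i :: nat. A i \<in> sets M" "\<And>i j. i \<le> j \<Longrightarrow> A j \<subseteq> A i" "measure M (\<Inter>i. A i) < e"
  shows "\<exists>n. measure M (A n) < e"
proof -
  have "(\<lambda>n. measure M (A n)) \<longlonglongrightarrow> measure M (\<Inter>i. A i)"
    using assms by (intro finite_Lim_measure_decseq) (auto simp: decseq_def)
  then have "eventually (\<lambda>n. measure M (A n) < e) sequentially"
    using assms(3) by (rule order_tendstoD)
  then show ?thesis
    by (auto simp: eventually_sequentially)
qed

section \<open>Elementary properties of a data set\<close>

locale data_set =
  fixes X :: "'a geom_data"
  assumes data: "geometric_data_set X"
begin

sublocale met: Metric_space "points X" "feature_dist X"
  using data by (simp add: geometric_data_set_def)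

sublocale prob: prob_space "prob_meas X"
  using data by (simp add: geometric_data_set_def)

lemma space_eq [simp]: "space (prob_meas X) = points X"
  and sets_eq: "sets (prob_meas X) = borel_sets met.mtopology"
  and mcomplete: met.mcomplete
  and separable: "separable_space met.mtopology"
  and features_nonempty: "features X \<noteq> {}"
  and features_ext: "features X \<subseteq> points X \<rightarrow>\<^sub>E UNIV"
  using data by (auto simp: geometric_data_set_def)

lemma full_support: "\<lbrakk>openin met.mtopology U; x \<in> U\<rbrakk> \<Longrightarrow> 0 < measure (prob_meas X) U"
  using data openin_subset[of met.mtopology U] by (auto simp: geometric_data_set_def)

lemma points_nonempty: "points X \<noteq> {}"
  using prob.not_empty by simp

lemma open_sets [measurable]: "openin met.mtopology U \<Longrightarrow> U \<in> sets (prob_meas X)"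
  by (simp add: sets_eq openin_borel_sets)

lemma closed_sets [measurable]: "closedin met.mtopology U \<Longrightarrow> U \<in> sets (prob_meas X)"
  by (simp add: sets_eq closedin_borel_sets)

lemma feature_diff_le:
  assumes "f \<in> features X" "x \<in> points X" "x' \<in> points X"
  shows "\<bar>f x - f x'\<bar> \<le> feature_dist X x x'"
proof -
  have "bdd_above ((\<lambda>f. \<bar>f x - f x'\<bar>) ` features X)"
    using data assms by (simp add: geometric_data_set_def)
  then show ?thesis
    using assms by (auto simp: feature_dist_def intro: cSUP_upper)
qed

lemma feature_dist_le:
  assumes "\<And>f. f \<in> features X \<Longrightarrow> \<bar>f x - f x'\<bar> \<le> c" "x \<in> points X" "x' \<in> points X"
  shows "feature_dist X x x' \<le> c"
  using assms features_nonempty by (auto simp: feature_dist_def intro: cSUP_least)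

lemma K_tau_iff:
  "u \<in> K_tau X \<longleftrightarrow> u \<in> points X \<rightarrow>\<^sub>E UNIV \<and>
    (\<forall>A e. finite A \<longrightarrow> A \<subseteq> points X \<longrightarrow> 0 < e \<longrightarrow>
      (\<exists>f\<in>features X. \<forall>a\<in>A. \<bar>u a - tau (f a)\<bar> < e))"
proof -
  have *: "(\<forall>a\<in>A. \<bar>u a - compose (points X) tau f a\<bar> < e) \<longleftrightarrow> (\<forall>a\<in>A. \<bar>u a - tau (f a)\<bar> < e)"
    if "A \<subseteq> points X" for A f e
    using that by (auto simp: compose_def subset_eq)
  show ?thesis
    unfolding K_tau_def
    by (subst in_closure_of_powertop_real) (auto simp: * PiE_def extensional_def cong: conj_cong,
      auto simp: compose_def)
qed

lemma K_tau_approx: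
  assumes "u \<in> K_tau X" "finite A" "A \<subseteq> points X" "0 < e"
  shows "\<exists>f\<in>features X. \<forall>a\<in>A. \<bar>u a - tau (f a)\<bar> < e"
  using assms unfolding K_tau_iff by blast

lemma features_closure_iff:
  "f \<in> features_closure X \<longleftrightarrow> f \<in> points X \<rightarrow>\<^sub>E UNIV \<and>
    (\<forall>A e. finite A \<longrightarrow> A \<subseteq> points X \<longrightarrow> 0 < e \<longrightarrow> (\<exists>g\<in>features X. \<forall>a\<in>A. \<bar>f a - g a\<bar> < e))"
  unfolding features_closure_def by (rule in_closure_of_powertop_real[OF features_ext])

text \<open>Composition with \<open>tau\<close> preserves closeness by the Lipschitz bound, and
  reflects it on a finite set because finitely many local moduli have a positive minimum. Thus the
  closure of the features can be recovered from \<open>K_tau\<close>, although \<open>K_tau\<close>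
  may also contain functions that take the values 1/2 or -1/2 and come from no real-valued
  function.\<close>

lemma compose_tau_in_K_tau_iff:
  assumes f: "f \<in> points X \<rightarrow>\<^sub>E UNIV"
  shows "compose (points X) tau f \<in> K_tau X \<longleftrightarrow> f \<in> features_closure X"
proof
  assume cl: "f \<in> features_closure X"
  show "compose (points X) tau f \<in> K_tau X"
    unfolding K_tau_iff
  proof (intro conjI allI impI)
    fix A and e :: real assume A: "finite A" "A \<subseteq> points X" and "0 < e"
    then obtain g where g: "g \<in> features X" "\<forall>a\<in>A. \<bar>f a - g a\<bar> < e"
      using cl unfolding features_closure_iff by meson
    have "\<bar>compose (points X) tau f a - tau (g a)\<bar> < e" if "a \<in> A" for a
      using A g(2) that tau_lipschitz[of "f a" "g a"] by (force simp: compose_def)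
    then show "\<exists>g\<in>features X. \<forall>a\<in>A. \<bar>compose (points X) tau f a - tau (g a)\<bar> < e"
      using g by blast
  qed (auto simp: compose_def)
next
  assume K: "compose (points X) tau f \<in> K_tau X"
  show "f \<in> features_closure X"
    unfolding features_closure_iff
  proof (intro conjI f allI impI)
    fix A and e :: real assume A: "finite A" "A \<subseteq> points X" and "0 < e"
    then have "\<forall>a. \<exists>c>0. \<forall>s. \<bar>tau s - tau (f a)\<bar> < c \<longrightarrow> \<bar>s - f a\<bar> < e"
      by (metis tau_inverse_continuous)
    then obtain c where c: "\<And>a. c a > 0" "\<And>a s. \<bar>tau s - tau (f a)\<bar> < c a \<Longrightarrow> \<bar>s - f a\<bar> < e"
      by metis
    have "Min (insert 1 (c ` A)) > 0"
      using A c by auto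
    then obtain g where g: "g \<in> features X"
        "\<And>a. a \<in> A \<Longrightarrow> \<bar>compose (points X) tau f a - tau (g a)\<bar> < Min (insert 1 (c ` A))"
      using K_tau_approx[OF K A] by blast
    have "\<bar>f a - g a\<bar> < e" if "a \<in> A" for a
    proof -
      have "\<bar>tau (g a) - tau (f a)\<bar> < c a"
        using g(2)[OF that] that A by (auto simp: compose_def subset_eq abs_minus_commute)
      from c(2)[OF this] show ?thesis
        by (simp add: abs_minus_commute)
    qed
    then show "\<exists>g\<in>features X. \<forall>a\<in>A. \<bar>f a - g a\<bar> < e"
      using g by auto
  qed
qed

lemma features_subset_closure: "features X \<subseteq> features_closure X"
proof
  fix f assume "f \<in> features X"
  moreover have "\<forall>a\<in>A. \<bar>f a - f a\<bar> < e" if "0 < e" for A :: "'a set" and e :: real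
    using that by simp
  ultimately show "f \<in> features_closure X"
    using features_ext unfolding features_closure_iff by blast
qed

lemma compose_tau_in_K_tau: "f \<in> features X \<Longrightarrow> compose (points X) tau f \<in> K_tau X"
  using compose_tau_in_K_tau_iff features_subset_closure features_ext by auto

lemma K_tau_nonempty: "K_tau X \<noteq> {}"
  using features_nonempty compose_tau_in_K_tau by auto

text \<open>Pointwise limits may reach the ends of the range of \<open>tau\<close>, hence the weak
  inequality.\<close>

lemma K_tau_bound:
  assumes u: "u \<in> K_tau X" and x: "x \<in> points X"
  shows "\<bar>u x\<bar> \<le> 1/2"
proof (rule field_le_epsilon)
  fix e :: real assume "0 < e"
  then obtain f where "\<bar>u x - tau (f x)\<bar> < e"
    using K_tau_approx[OF u, of "{x}" e] x by auto
  then show "\<bar>u x\<bar> \<le> 1/2 + e"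
    using abs_tau_less_half[of "f x"] by linarith
qed

text \<open>A Lipschitz bound involves only two points at a time, so it survives pointwise
  closure.\<close>

lemma K_tau_lipschitz:
  assumes u: "u \<in> K_tau X" and x: "x \<in> points X" "x' \<in> points X"
  shows "\<bar>u x - u x'\<bar> \<le> feature_dist X x x'"
proof (rule field_le_epsilon)
  fix e :: real assume "0 < e"
  then obtain f where f: "f \<in> features X" "\<bar>u x - tau (f x)\<bar> < e/2" "\<bar>u x' - tau (f x')\<bar> < e/2"
    using K_tau_approx[OF u, of "{x, x'}" "e/2"] x by auto
  have "\<bar>tau (f x) - tau (f x')\<bar> \<le> feature_dist X x x'"
    using tau_lipschitz feature_diff_le[OF f(1) x] order_trans by blast
  with f show "\<bar>u x - u x'\<bar> \<le> feature_dist X x x' + e"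
    by linarith
qed

lemma K_tau_measurable:
  assumes "u \<in> K_tau X" shows "u \<in> borel_measurable (prob_meas X)"
proof (rule borel_measurable_continuous_map)
  show "continuous_map met.mtopology euclideanreal u"
  proof -
    have "continuous_map met.mtopology Met_TC.mtopology u"
      unfolding met.metric_continuous_map[OF Met_TC.Metric_space_axioms]
    proof (intro conjI ballI allI impI)
      fix x and e :: real assume x: "x \<in> points X" and "0 < e"
      then have "\<forall>y. y \<in> points X \<and> feature_dist X x y < e \<longrightarrow> dist (u x) (u y) < e"
        using K_tau_lipschitz[OF assms x] by (fastforce simp: dist_real_def)
      then show "\<exists>c>0. \<forall>y. y \<in> points X \<and> feature_dist X x y < c \<longrightarrow> dist (u x) (u y) < e"
        using \<open>0 < e\<close> by blast
    qed auto
    then show ?thesis by simp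
  qed
qed (auto simp: sets_eq)

lemma dense_sequence:
  "\<exists>s :: nat \<Rightarrow> 'a. (\<forall>i. s i \<in> points X) \<and>
    (\<forall>x\<in>points X. \<forall>e>0. \<exists>i. feature_dist X x (s i) < e)"
proof -
  obtain C where C: "countable C" "C \<subseteq> points X" "met.mtopology closure_of C = points X"
    using separable by (auto simp: separable_space_def)
  have near: "\<exists>y\<in>C. feature_dist X x y < e" if "x \<in> points X" "0 < e" for x e
    using C(3) that unfolding met.metric_closure_of by fastforce
  have "C \<noteq> {}"
    using near points_nonempty zero_less_one by blast
  show ?thesis
  proof (intro exI[of _ "from_nat_into C"] conjI allI ballI impI)
    show "from_nat_into C i \<in> points X" for i
      using from_nat_into[OF \<open>C \<noteq> {}\<close>] C(2) by blast
    show "\<exists>i. feature_dist X x (from_nat_into C i) < e" if "x \<in> points X" "0 < e" for x e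
      using near[OF that] from_nat_into_surj[OF C(1)] by metis
  qed
qed

text \<open>The balls of radius \<open>1 / Suc n\<close> about a dense sequence form a base. This is
  what makes open sets of a product countable unions of rectangles.\<close>

lemma second_countable: "second_countable met.mtopology"
proof -
  obtain s :: "nat \<Rightarrow> 'a" where s: "\<And>i. s i \<in> points X"
    "\<And>x e. \<lbrakk>x \<in> points X; 0 < e\<rbrakk> \<Longrightarrow> \<exists>i. feature_dist X x (s i) < e"
    using dense_sequence by metis
  define \<B> where "\<B> = (\<lambda>(i, n). met.mball (s i) (1 / Suc n)) ` (UNIV :: (nat \<times> nat) set)"
  show ?thesis
    unfolding second_countable_def
  proof (intro exI[of _ \<B>] conjI ballI allI impI)
    show "countable \<B>"
      by (simp add: \<B>_def)
    fix U x assume Ux: "openin met.mtopology U \<and> x \<in> U"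
    then obtain r where r: "r > 0" "met.mball x r \<subseteq> U" and x: "x \<in> points X"
      unfolding met.openin_mtopology by blast
    obtain n where n: "1 / Suc n < r / 2"
      using nat_approx_posE[of "r/2"] r by auto
    obtain i where i: "feature_dist X x (s i) < 1 / Suc n"
      using s(2)[OF x, of "1 / Suc n"] by auto
    have "x \<in> met.mball (s i) (1 / Suc n)"
      using i x s(1) by (simp add: met.commute)
    moreover have "met.mball (s i) (1 / Suc n) \<subseteq> met.mball x r"
      using i n s(1) by (intro met.mball_subset x) (simp add: met.commute)
    ultimately show "\<exists>V\<in>\<B>. x \<in> V \<and> V \<subseteq> U"
      using r(2) by (intro bexI[of _ "met.mball (s i) (1 / Suc n)"]) (auto simp: \<B>_def)
  qed (auto simp: \<B>_def)
qed

text \<open>A point is labelled by the first member of a dense sequence at distance less than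
  \<open>e/2\<close>. A measurable label encodes the partition conveniently: lying in a common cell
  becomes an equation.\<close>

lemma countable_partition:
  assumes "0 < e"
  obtains n :: "'a \<Rightarrow> nat" where "n \<in> prob_meas X \<rightarrow>\<^sub>M count_space UNIV"
    "\<And>x x'. \<lbrakk>x \<in> points X; x' \<in> points X; n x = n x'\<rbrakk> \<Longrightarrow> feature_dist X x x' < e"
proof -
  obtain s :: "nat \<Rightarrow> 'a" where s: "\<And>i. s i \<in> points X"
    "\<And>x e. \<lbrakk>x \<in> points X; 0 < e\<rbrakk> \<Longrightarrow> \<exists>i. feature_dist X x (s i) < e"
    using dense_sequence by metis
  define n where "n = (\<lambda>x. LEAST i. x \<in> met.mball (s i) (e/2))"
  have n: "x \<in> met.mball (s (n x)) (e/2)" if x: "x \<in> points X" for x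
  proof -
    obtain i where "feature_dist X x (s i) < e/2"
      using s(2)[of x "e/2"] x assms by auto
    then have "x \<in> met.mball (s i) (e/2)"
      using s(1) x by (simp add: met.commute)
    then show ?thesis
      unfolding n_def by (rule LeastI)
  qed
  show ?thesis
  proof
    have "Measurable.pred (prob_meas X) (\<lambda>x. x \<in> met.mball (s i) (e/2))" for i
      by (rule pred_sets2[OF open_sets[OF met.openin_mball] measurable_ident_sets[OF refl, unfolded id_def]])
    then show "n \<in> prob_meas X \<rightarrow>\<^sub>M count_space UNIV"
      unfolding n_def by (intro measurable_Least) auto
    fix x x' assume x: "x \<in> points X" "x' \<in> points X" and eq: "n x = n x'"
    have "feature_dist X x x' \<le> feature_dist X (s (n x)) x + feature_dist X (s (n x)) x'"
      using x s(1) by (intro met.triangle'') auto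
    then show "feature_dist X x x' < e"
      using n[OF x(1)] n[OF x(2)] eq by auto
  qed
qed
end

section \<open>Couplings and the cost of a pair of functions\<close>

context data_set
begin

lemma K_tau_diff_bound:
  "\<lbrakk>u \<in> K_tau X; v \<in> K_tau X; x \<in> points X; y \<in> points X\<rbrakk> \<Longrightarrow> \<bar>u x - v y\<bar> \<le> 1"
  using K_tau_bound[of u x] K_tau_bound[of v y] by linarith

text \<open>Finitely many small cells carry all but mass \<open>e\<close>. On them, closeness at one
  representative spreads by the Lipschitz bounds of \<open>u\<close> and \<open>v\<close>, giving
  \<open>3 * e\<close>; on the rest the difference is at most 1, giving another
  \<open>e\<close>.\<close>

lemma finite_net:
  assumes "0 < e"
  shows "\<exists>A\<subseteq>points X. finite A \<and> (\<forall>u\<in>K_tau X. \<forall>v\<in>K_tau X.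
    (\<forall>a\<in>A. \<bar>u a - v a\<bar> < e) \<longrightarrow> (\<integral>x. \<bar>u x - v x\<bar> \<partial>prob_meas X) < 4 * e)"
proof -
  obtain n :: "'a \<Rightarrow> nat" where n [measurable]: "n \<in> prob_meas X \<rightarrow>\<^sub>M count_space UNIV"
    and cell: "\<And>x x'. \<lbrakk>x \<in> points X; x' \<in> points X; n x = n x'\<rbrakk> \<Longrightarrow> feature_dist X x x' < e"
    using countable_partition[OF assms] by metis
  define B where "B k = {x \<in> space (prob_meas X). n x > k}" for k
  have B [measurable]: "B k \<in> prob.events" for k
    unfolding B_def by measurable
  have "\<exists>k. prob.prob (B k) < e"
  proof (rule prob.decseq_measure_less)
    have "(\<Inter>k. B k) = {}"
      by (auto simp: B_def)
    then show "prob.prob (\<Inter>k. B k) < e"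
      using assms by simp
  qed (auto simp: B_def)
  then obtain k where k: "prob.prob (B k) < e" ..
  define J where "J = n ` points X \<inter> {..k}"
  \<comment> \<open>One representative of each nonempty cell with label at most
    \<open>k\<close>.\<close>
  define A where "A = inv_into (points X) n ` J"
  show ?thesis
  proof (intro exI[of _ A] conjI ballI impI)
    show "finite A" "A \<subseteq> points X"
      by (auto simp: A_def J_def intro: inv_into_into)
    fix u v assume u: "u \<in> K_tau X" and v: "v \<in> K_tau X"
      and A: "\<forall>a\<in>A. \<bar>u a - v a\<bar> < e"
    note [measurable] = K_tau_measurable[OF u] K_tau_measurable[OF v]
    have le: "\<bar>u x - v x\<bar> \<le> 3 * e + indicator (B k) x" if x: "x \<in> points X" for x
    proof (cases "x \<in> B k")
      case True
      then show ?thesis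
        using K_tau_diff_bound[OF u v x x] assms by simp
    next
      case False
      then have "n x \<in> J"
        using x by (auto simp: B_def J_def)
      define a where "a = inv_into (points X) n (n x)"
      have a: "a \<in> points X" "n a = n x" "a \<in> A"
        using \<open>n x \<in> J\<close> by (auto simp: a_def A_def J_def intro: inv_into_into f_inv_into_f)
      have "feature_dist X a x < e" "\<bar>u a - v a\<bar> < e"
        using a x cell A by auto
      with K_tau_lipschitz[OF u a(1) x] K_tau_lipschitz[OF v a(1) x]
      show ?thesis
        using False by simp
    qed
    have "(\<integral>x. \<bar>u x - v x\<bar> \<partial>prob_meas X) \<le> (\<integral>x. 3 * e + indicator (B k) x \<partial>prob_meas X)"
    proof (rule integral_mono)
      show "integrable (prob_meas X) (\<lambda>x. \<bar>u x - v x\<bar>)"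
        by (rule prob.integrable_const_bound[where B=1]) (auto intro!: K_tau_diff_bound u v)
    qed (use le in \<open>auto simp: prob.emeasure_eq_measure\<close>)
    also have "\<dots> = 3 * e + prob.prob (B k)"
      by (subst Bochner_Integration.integral_add)
         (auto simp: prob.prob_space[simplified] prob.emeasure_eq_measure B_def Int_absorb2 subset_eq
           intro!: arg_cong[where f=prob.prob])
    finally show "(\<integral>x. \<bar>u x - v x\<bar> \<partial>prob_meas X) < 4 * e"
      using k by simp
  qed
qed

text \<open>Rounding the values on a finite net to a grid of width \<open>c\<close> leaves finitely
  many patterns, because values are bounded. Functions with equal patterns differ by less than
  \<open>c\<close> on the net, hence by less than \<open>4 * c = e\<close> in mean.\<close>

lemma K_tau_totally_bounded:
  assumes "0 < e"
  shows "\<exists>N\<subseteq>K_tau X. finite N \<and> (\<forall>v\<in>K_tau X. \<exists>w\<in>N. (\<integral>x. \<bar>v x - w x\<bar> \<partial>prob_meas X) < e)"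
proof -
  define c where "c = e / 4"
  have c: "0 < c" using assms by (simp add: c_def)
  obtain A where A: "finite A" "A \<subseteq> points X"
    "\<forall>u\<in>K_tau X. \<forall>v\<in>K_tau X. (\<forall>a\<in>A. \<bar>u a - v a\<bar> < c) \<longrightarrow>
       (\<integral>x. \<bar>u x - v x\<bar> \<partial>prob_meas X) < 4 * c"
    using finite_net[OF c] by blast
  define h where "h v = (\<lambda>a\<in>A. \<lfloor>v a / c\<rfloor>)" for v :: "'a \<Rightarrow> real"
  have "h ` K_tau X \<subseteq> A \<rightarrow>\<^sub>E {\<lfloor>(-1/2) / c\<rfloor>..\<lfloor>(1/2) / c\<rfloor>}"
  proof -
    have "\<lfloor>(-1/2) / c\<rfloor> \<le> \<lfloor>v a / c\<rfloor> \<and> \<lfloor>v a / c\<rfloor> \<le> \<lfloor>(1/2) / c\<rfloor>" if "v \<in> K_tau X" "a \<in> A" for v a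
      using K_tau_bound[OF that(1), of a] A(2) that(2) c
      by (intro conjI floor_mono divide_right_mono) (auto simp: abs_le_iff)
    then show ?thesis
      by (auto simp: h_def)
  qed
  then have fin: "finite (h ` K_tau X)"
    using A(1) by (meson finite_PiE finite_atLeastAtMost_int finite_subset)
  \<comment> \<open>One function of \<open>K_tau\<close> for each pattern that occurs, so that the
    net consists of members of \<open>K_tau\<close>.\<close>
  define N where "N = inv_into (K_tau X) h ` h ` K_tau X"
  show ?thesis
  proof (intro exI[of _ N] conjI ballI)
    show "finite N" "N \<subseteq> K_tau X"
      using fin by (auto simp: N_def intro: inv_into_into)
    fix v assume v: "v \<in> K_tau X"
    define w where "w = inv_into (K_tau X) h (h v)"
    have w: "w \<in> N" "w \<in> K_tau X" "h w = h v"
      using v f_inv_into_f[of "h v" h "K_tau X"] by (auto simp: w_def N_def intro: inv_into_into)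
    have "\<bar>v a - w a\<bar> < c" if "a \<in> A" for a
    proof -
      have "\<lfloor>v a / c\<rfloor> = \<lfloor>w a / c\<rfloor>"
        using fun_cong[OF w(3), of a] that by (simp add: h_def)
      then have "\<bar>v a / c - w a / c\<bar> < 1"
        by linarith
      then show ?thesis
        using c by (simp add: diff_divide_distrib[symmetric])
    qed
    then show "\<exists>w\<in>N. (\<integral>x. \<bar>v x - w x\<bar> \<partial>prob_meas X) < e"
      using A(3)[rule_format, OF v w(2)] w(1) by (auto simp: c_def)
  qed
qed

text \<open>Pointwise closure alone says nothing about integrals; the finite net does. This reduces
  statements about \<open>K_tau\<close> to functions \<open>tau \<circ> f\<close>, which can be
  transported along an isomorphism.\<close>

lemma K_tau_L1_approx:
  assumes u: "u \<in> K_tau X" and "0 < e"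
  obtains f where "f \<in> features X"
    "(\<integral>x. \<bar>u x - compose (points X) tau f x\<bar> \<partial>prob_meas X) < e"
proof -
  obtain A where A: "finite A" "A \<subseteq> points X"
    "\<forall>u\<in>K_tau X. \<forall>v\<in>K_tau X. (\<forall>a\<in>A. \<bar>u a - v a\<bar> < e / 4) \<longrightarrow>
       (\<integral>x. \<bar>u x - v x\<bar> \<partial>prob_meas X) < 4 * (e / 4)"
    using finite_net[of "e/4"] \<open>0 < e\<close> by auto
  obtain f where f: "f \<in> features X" "\<And>a. a \<in> A \<Longrightarrow> \<bar>u a - tau (f a)\<bar> < e / 4"
    using K_tau_approx[OF u A(1,2), of "e/4"] \<open>0 < e\<close> by auto
  have "\<bar>u a - compose (points X) tau f a\<bar> < e / 4" if "a \<in> A" for a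
    using f(2)[OF that] A(2) that by (auto simp: compose_def subset_eq)
  then show thesis
    using that[OF f(1)] A(3)[rule_format, OF u compose_tau_in_K_tau[OF f(1)]] by simp
qed

end

text \<open>The base is kept as a set of pairs so that both sides of each rectangle stay accessible,
  as the generation of Borel sets and the support argument require.\<close>

lemma second_countable_prod_base:
  assumes "second_countable T" "second_countable T'"
  obtains \<B> where "countable \<B>"
    "\<And>U V. (U, V) \<in> \<B> \<Longrightarrow> openin T U \<and> openin T' V"
    "\<And>W x y. \<lbrakk>openin (prod_topology T T') W; (x, y) \<in> W\<rbrakk> \<Longrightarrow>
       \<exists>U V. (U, V) \<in> \<B> \<and> x \<in> U \<and> y \<in> V \<and> U \<times> V \<subseteq> W"
proof -
  obtain \<A> where A: "countable \<A>" "\<And>V. V \<in> \<A> \<Longrightarrow> openin T V"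
     "\<And>U x. \<lbrakk>openin T U; x \<in> U\<rbrakk> \<Longrightarrow> \<exists>V \<in> \<A>. x \<in> V \<and> V \<subseteq> U"
    using assms(1) unfolding second_countable_def by metis
  obtain \<C> where C: "countable \<C>" "\<And>V. V \<in> \<C> \<Longrightarrow> openin T' V"
     "\<And>U x. \<lbrakk>openin T' U; x \<in> U\<rbrakk> \<Longrightarrow> \<exists>V \<in> \<C>. x \<in> V \<and> V \<subseteq> U"
    using assms(2) unfolding second_countable_def by metis
  show thesis
  proof
    show "countable (\<A> \<times> \<C>)"
      using A C by auto
    fix W x y assume W: "openin (prod_topology T T') W" "(x, y) \<in> W"
    obtain U V where "openin T U" "openin T' V" "x \<in> U" "y \<in> V" "U \<times> V \<subseteq> W"
      using iffD1[OF openin_prod_topology_alt W(1)] W(2) by meson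
    moreover obtain U' where "U' \<in> \<A>" "x \<in> U'" "U' \<subseteq> U"
      using A(3) \<open>openin T U\<close> \<open>x \<in> U\<close> by blast
    moreover obtain V' where "V' \<in> \<C>" "y \<in> V'" "V' \<subseteq> V"
      using C(3) \<open>openin T' V\<close> \<open>y \<in> V\<close> by blast
    ultimately show "\<exists>U V. (U, V) \<in> \<A> \<times> \<C> \<and> x \<in> U \<and> y \<in> V \<and> U \<times> V \<subseteq> W"
      by blast
  qed (use A C in auto)
qed

text \<open>An open set is a countable union of open rectangles by second countability; conversely,
  measurable rectangles are intersections of preimages under continuous projections. This identifies
  the Borel sets in the definition of couplings with the product sigma-algebra.\<close>

lemma borel_sets_prod_topology:
  assumes sc: "second_countable T" "second_countable T'"
    and M: "space M = topspace T" "sets M = borel_sets T"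
    and N: "space N = topspace T'" "sets N = borel_sets T'"
  shows "borel_sets (prod_topology T T') = sets (M \<Otimes>\<^sub>M N)"
proof (rule antisym)
  let ?P = "prod_topology T T'"
  obtain \<B> where B: "countable \<B>" "\<And>U V. (U, V) \<in> \<B> \<Longrightarrow> openin T U \<and> openin T' V"
    "\<And>W x y. \<lbrakk>openin ?P W; (x, y) \<in> W\<rbrakk> \<Longrightarrow> \<exists>U V. (U, V) \<in> \<B> \<and> x \<in> U \<and> y \<in> V \<and> U \<times> V \<subseteq> W"
    using second_countable_prod_base[OF sc] by metis
  have "W \<in> sets (M \<Otimes>\<^sub>M N)" if W: "openin ?P W" for W
  proof -
    have "W = (\<Union>(U, V) \<in> {(U, V) \<in> \<B>. U \<times> V \<subseteq> W}. U \<times> V)"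
      using B(3)[OF W] by fast
    also have "\<dots> \<in> sets (M \<Otimes>\<^sub>M N)"
      using B(2) by (intro sets.countable_UN' countable_subset[OF _ B(1)])
        (auto simp: M N intro!: pair_measureI openin_borel_sets)
    finally show ?thesis .
  qed
  then show "borel_sets ?P \<subseteq> sets (M \<Otimes>\<^sub>M N)"
    unfolding borel_sets_def
    by (intro sets.sigma_sets_subset[where M="M \<Otimes>\<^sub>M N", unfolded space_pair_measure M N topspace_prod_topology[symmetric]]) auto
  define Q where "Q = sigma (topspace ?P) {U. openin ?P U}"
  have sub: "{U. openin ?P U} \<subseteq> Pow (topspace ?P)"
    using openin_subset by blast
  have Q: "space Q = topspace ?P" "sets Q = borel_sets ?P"
    using sub by (auto simp: Q_def borel_sets_def)
  have [measurable]: "fst \<in> Q \<rightarrow>\<^sub>M M" "snd \<in> Q \<rightarrow>\<^sub>M N"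
    by (rule measurable_continuous_map[OF _ Q M] measurable_continuous_map[OF _ Q N];
        simp add: continuous_map_fst continuous_map_snd)+
  have "a \<times> b \<in> sets Q" if "a \<in> sets M" "b \<in> sets N" for a b
  proof -
    have "a \<times> b = (fst -` a \<inter> space Q) \<inter> (snd -` b \<inter> space Q)"
      using sets.sets_into_space[OF that(1)] sets.sets_into_space[OF that(2)]
      by (auto simp: Q M N)
    also have "\<dots> \<in> sets Q"
      using that by measurable
    finally show ?thesis .
  qed
  then have "sigma_sets (space Q) {a \<times> b |a b. a \<in> sets M \<and> b \<in> sets N} \<subseteq> sets Q"
    by (intro sets.sigma_sets_subset) auto
  then show "sets (M \<Otimes>\<^sub>M N) \<subseteq> borel_sets ?P"
    by (simp add: sets_pair_measure Q M N)
qed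

text \<open>The bounds on \<open>f\<close> make the total operators \<open>SUP\<close> and
  \<open>INF\<close> behave. The slack \<open>e\<close> appears because the inner infimum need not
  be attained.\<close>

lemma SUP_INF_le_iff:
  fixes f :: "'a \<Rightarrow> 'b \<Rightarrow> real"
  assumes ne: "A \<noteq> {}" "B \<noteq> {}" and f: "\<And>a b. \<lbrakk>a \<in> A; b \<in> B\<rbrakk> \<Longrightarrow> 0 \<le> f a b \<and> f a b \<le> 1"
  shows "(SUP a\<in>A. INF b\<in>B. f a b) \<le> c \<longleftrightarrow> (\<forall>a\<in>A. \<forall>e>0. \<exists>b\<in>B. f a b < c + e)"
proof -
  have bb: "bdd_below (f a ` B)" if "a \<in> A" for a
    using f that by (auto simp: bdd_below_def)
  obtain b0 where b0: "b0 \<in> B" using ne by auto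
  have "(INF b\<in>B. f a b) \<le> 1" if "a \<in> A" for a
    using cINF_lower[OF bb[OF that] b0] f[OF that b0] by linarith
  then have "(SUP a\<in>A. INF b\<in>B. f a b) \<le> c \<longleftrightarrow> (\<forall>a\<in>A. (INF b\<in>B. f a b) \<le> c)"
    by (intro cSUP_le_iff ne) (auto simp: bdd_above_def)
  also have "\<dots> \<longleftrightarrow> (\<forall>a\<in>A. \<forall>e>0. (INF b\<in>B. f a b) < c + e)"
    by (meson field_le_epsilon less_add_same_cancel1 less_eq_real_def less_le_trans not_le)
  also have "\<dots> \<longleftrightarrow> (\<forall>a\<in>A. \<forall>e>0. \<exists>b\<in>B. f a b < c + e)"
    by (simp add: cINF_less_iff[OF ne(2) bb])
  finally show ?thesis .
qed

text \<open>This is \<open>L1_dist\<close> of the two pulled-back functions, freed from the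
  truncation by \<open>compose\<close>; on the space of a coupling both integrands agree.\<close>

definition cost :: "('a \<times> 'b) measure \<Rightarrow> ('a \<Rightarrow> real) \<Rightarrow> ('b \<Rightarrow> real) \<Rightarrow> real" where
  "cost \<pi> u v = (\<integral>p. \<bar>u (fst p) - v (snd p)\<bar> \<partial>\<pi>)"

locale data_pair = X: data_set X + Y: data_set Y
  for X :: "'a geom_data" and Y :: "'b geom_data"
begin

lemma borel_sets_eq:
  "borel_sets (prod_topology X.met.mtopology Y.met.mtopology) = sets (prob_meas X \<Otimes>\<^sub>M prob_meas Y)"
  by (rule borel_sets_prod_topology)
     (auto simp: X.second_countable Y.second_countable X.sets_eq Y.sets_eq)

lemma coupling_iff:
  "\<pi> \<in> couplings X Y \<longleftrightarrow> prob_space \<pi> \<and> sets \<pi> = sets (prob_meas X \<Otimes>\<^sub>M prob_meas Y) \<and>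
    distr \<pi> (prob_meas X) fst = prob_meas X \<and> distr \<pi> (prob_meas Y) snd = prob_meas Y"
  unfolding couplings_def borel_sets_eq
  by (auto simp: space_pair_measure dest: sets_eq_imp_space_eq)

lemma K_tau_diff_bound: "\<lbrakk>u \<in> K_tau X; v \<in> K_tau Y; x \<in> points X; y \<in> points Y\<rbrakk> \<Longrightarrow> \<bar>u x - v y\<bar> \<le> 1"
  using X.K_tau_bound[of u x] Y.K_tau_bound[of v y] by linarith

text \<open>Couplings exist, so the infimum defining \<open>d_tau\<close> ranges over a nonempty
  set.\<close>

lemma product_coupling: "prob_meas X \<Otimes>\<^sub>M prob_meas Y \<in> couplings X Y"
proof -
  interpret pair_prob_space "prob_meas X" "prob_meas Y" ..
  have "distr (prob_meas X \<Otimes>\<^sub>M prob_meas Y) (prob_meas Y) snd = prob_meas Y"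
  proof (rule measure_eqI)
    fix B assume "B \<in> sets (distr (prob_meas X \<Otimes>\<^sub>M prob_meas Y) (prob_meas Y) snd)"
    then have B: "B \<in> sets (prob_meas Y)" by simp
    have "snd -` B \<inter> space (prob_meas X \<Otimes>\<^sub>M prob_meas Y) = space (prob_meas X) \<times> B"
      using sets.sets_into_space[OF B] by (auto simp: space_pair_measure)
    then show "emeasure (distr (prob_meas X \<Otimes>\<^sub>M prob_meas Y) (prob_meas Y) snd) B = emeasure (prob_meas Y) B"
      using B by (simp add: emeasure_distr Y.prob.emeasure_pair_measure_Times X.prob.emeasure_space_1 del: X.space_eq)
  qed simp
  then show ?thesis
    unfolding coupling_iff
    by (auto simp: prob_space_axioms Y.prob.distr_pair_fst)
qed

context
  fixes \<pi> assumes \<pi>: "\<pi> \<in> couplings X Y"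
begin

interpretation \<pi>: prob_space \<pi>
  using \<pi> by (simp add: coupling_iff)

lemma coupling_sets [measurable_cong]: "sets \<pi> = sets (prob_meas X \<Otimes>\<^sub>M prob_meas Y)"
  using \<pi> by (simp add: coupling_iff)

lemma coupling_space: "space \<pi> = points X \<times> points Y"
  using sets_eq_imp_space_eq[OF coupling_sets] by (simp add: space_pair_measure)

lemma coupling_measurable: "fst \<in> \<pi> \<rightarrow>\<^sub>M prob_meas X" "snd \<in> \<pi> \<rightarrow>\<^sub>M prob_meas Y"
  by measurable

lemma coupling_distr: "distr \<pi> (prob_meas X) fst = prob_meas X" "distr \<pi> (prob_meas Y) snd = prob_meas Y"
  using \<pi> by (auto simp: coupling_iff)

lemma coupling_AE_fst: "AE x in prob_meas X. P x \<Longrightarrow> AE p in \<pi>. P (fst p)"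
  by (rule AE_distrD[OF coupling_measurable(1)]) (unfold coupling_distr)

lemma coupling_AE_snd: "AE y in prob_meas Y. P y \<Longrightarrow> AE p in \<pi>. P (snd p)"
  by (rule AE_distrD[OF coupling_measurable(2)]) (unfold coupling_distr)

lemma coupling_integral_fst:
  fixes f :: "'a \<Rightarrow> real"
  assumes "f \<in> borel_measurable (prob_meas X)"
  shows "(\<integral>p. f (fst p) \<partial>\<pi>) = integral\<^sup>L (prob_meas X) f"
  using integral_distr[OF coupling_measurable(1) assms] \<pi> by (simp add: coupling_iff)

lemma coupling_integral_snd:
  fixes f :: "'b \<Rightarrow> real"
  assumes "f \<in> borel_measurable (prob_meas Y)"
  shows "(\<integral>p. f (snd p) \<partial>\<pi>) = integral\<^sup>L (prob_meas Y) f"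
  using integral_distr[OF coupling_measurable(2) assms] \<pi> by (simp add: coupling_iff)

lemma coupling_measure_fst:
  assumes "A \<in> sets (prob_meas X)" shows "measure \<pi> (A \<times> points Y) = measure (prob_meas X) A"
proof -
  have "fst -` A \<inter> space \<pi> = A \<times> points Y"
    using sets.sets_into_space[OF assms] by (auto simp: coupling_space)
  then show ?thesis
    using measure_distr[OF coupling_measurable(1) assms] \<pi> by (simp add: coupling_iff)
qed

lemma coupling_measure_snd:
  assumes "B \<in> sets (prob_meas Y)" shows "measure \<pi> (points X \<times> B) = measure (prob_meas Y) B"
proof -
  have "snd -` B \<inter> space \<pi> = points X \<times> B"
    using sets.sets_into_space[OF assms] by (auto simp: coupling_space)
  then show ?thesis
    using measure_distr[OF coupling_measurable(2) assms] \<pi> by (simp add: coupling_iff)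
qed

lemma cost_measurable:
  assumes "u \<in> K_tau X" "v \<in> K_tau Y"
  shows "(\<lambda>p. \<bar>u (fst p) - v (snd p)\<bar>) \<in> borel_measurable \<pi>"
  using X.K_tau_measurable[OF assms(1)] Y.K_tau_measurable[OF assms(2)] by measurable

lemma cost_integrable:
  assumes "u \<in> K_tau X" "v \<in> K_tau Y"
  shows "integrable \<pi> (\<lambda>p. \<bar>u (fst p) - v (snd p)\<bar>)"
  by (rule \<pi>.integrable_const_bound[where B=1])
     (auto intro!: cost_measurable assms K_tau_diff_bound simp: coupling_space)

lemma cost_bounds:
  assumes "u \<in> K_tau X" "v \<in> K_tau Y"
  shows "0 \<le> cost \<pi> u v \<and> cost \<pi> u v \<le> 1"
proof -
  have "cost \<pi> u v \<le> (\<integral>p. 1 \<partial>\<pi>)"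
    unfolding cost_def
    by (intro integral_mono cost_integrable assms) (auto intro!: K_tau_diff_bound assms simp: coupling_space)
  then show ?thesis
    by (simp add: cost_def \<pi>.prob_space)
qed

lemma D_tau_eq_cost:
  "D_tau \<pi> X Y =
    max (SUP u\<in>K_tau X. INF v\<in>K_tau Y. cost \<pi> u v) (SUP v\<in>K_tau Y. INF u\<in>K_tau X. cost \<pi> u v)"
proof -
  have "L1_dist \<pi> (compose (points X \<times> points Y) u fst) (compose (points X \<times> points Y) v snd) = cost \<pi> u v" for u v
    unfolding L1_dist_def cost_def
    by (rule Bochner_Integration.integral_cong) (auto simp: coupling_space compose_def)
  then show ?thesis
    by (simp add: D_tau_def hausdorff_dist_def image_image)
qed

text \<open>Both halves of the Hausdorff distance turn into approximate choices of a partner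
  function. All later estimates of \<open>D_tau\<close> go through this form.\<close>

lemma D_tau_le_iff:
  "D_tau \<pi> X Y \<le> c \<longleftrightarrow>
    (\<forall>u\<in>K_tau X. \<forall>e>0. \<exists>v\<in>K_tau Y. cost \<pi> u v < c + e) \<and>
    (\<forall>v\<in>K_tau Y. \<forall>e>0. \<exists>u\<in>K_tau X. cost \<pi> u v < c + e)"
  unfolding D_tau_eq_cost max.bounded_iff
  using SUP_INF_le_iff[of "K_tau X" "K_tau Y" "cost \<pi>" c]
    SUP_INF_le_iff[of "K_tau Y" "K_tau X" "\<lambda>v u. cost \<pi> u v" c] cost_bounds
    X.K_tau_nonempty Y.K_tau_nonempty by auto

lemma D_tau_nonneg: "0 \<le> D_tau \<pi> X Y"
proof (rule ccontr)
  assume "\<not> 0 \<le> D_tau \<pi> X Y"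
  \<comment> \<open>Using \<open>- D_tau \<pi> X Y\<close> as the slack would produce a negative
    cost.\<close>
  then have "0 < - D_tau \<pi> X Y" by simp
  obtain u where u: "u \<in> K_tau X"
    using X.K_tau_nonempty by auto
  then obtain v where "v \<in> K_tau Y" "cost \<pi> u v < D_tau \<pi> X Y + - D_tau \<pi> X Y"
    using D_tau_le_iff[of "D_tau \<pi> X Y"] \<open>0 < - D_tau \<pi> X Y\<close> by blast
  then show False
    using cost_bounds[OF u] by fastforce
qed


end

lemma d_tau_le_D_tau: "\<pi> \<in> couplings X Y \<Longrightarrow> d_tau X Y \<le> D_tau \<pi> X Y"
  unfolding d_tau_def using D_tau_nonneg by (intro cINF_lower) (auto simp: bdd_below_def)

lemma d_tau_nonneg: "0 \<le> d_tau X Y"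
  unfolding d_tau_def using D_tau_nonneg product_coupling by (intro cINF_greatest) auto

lemma near_optimal_coupling:
  assumes "d_tau X Y < c"
  obtains \<pi> where "\<pi> \<in> couplings X Y" "D_tau \<pi> X Y < c"
  using assms D_tau_nonneg product_coupling unfolding d_tau_def
  by (subst (asm) cINF_less_iff) (auto simp: bdd_below_def)

end

lemma swap_coupling:
  assumes "data_pair X Y" and \<pi>: "\<pi> \<in> couplings X Y"
  defines "\<pi>' \<equiv> distr \<pi> (prob_meas Y \<Otimes>\<^sub>M prob_meas X) (\<lambda>(x, y). (y, x))"
  shows "\<pi>' \<in> couplings Y X" "D_tau \<pi>' Y X = D_tau \<pi> X Y"
proof -
  interpret XY: data_pair X Y by fact
  interpret YX: data_pair Y X ..
  interpret \<pi>: prob_space \<pi> using \<pi> by (simp add: XY.coupling_iff)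
  have sets [measurable_cong]: "sets \<pi> = sets (prob_meas X \<Otimes>\<^sub>M prob_meas Y)"
    by (rule XY.coupling_sets[OF \<pi>])
  have swap: "(\<lambda>(x, y). (y, x)) \<in> \<pi> \<rightarrow>\<^sub>M prob_meas Y \<Otimes>\<^sub>M prob_meas X"
    unfolding measurable_cong_sets[OF sets refl] by (rule measurable_pair_swap')
  show *: "\<pi>' \<in> couplings Y X"
    unfolding YX.coupling_iff
  proof (intro conjI)
    show "prob_space \<pi>'"
      unfolding \<pi>'_def by (rule \<pi>.prob_space_distr[OF swap])
    have "fst \<circ> (\<lambda>(x, y). (y, x)) = (snd :: 'a \<times> 'b \<Rightarrow> 'b)" "snd \<circ> (\<lambda>(x, y). (y, x)) = (fst :: 'a \<times> 'b \<Rightarrow> 'a)"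
      by auto
    then show "distr \<pi>' (prob_meas Y) fst = prob_meas Y" "distr \<pi>' (prob_meas X) snd = prob_meas X"
      using \<pi> unfolding \<pi>'_def
      by (simp_all add: distr_distr[OF measurable_fst swap] distr_distr[OF measurable_snd swap] XY.coupling_iff)
  qed (simp add: \<pi>'_def)
  have cost: "cost \<pi>' v u = cost \<pi> u v" if "u \<in> K_tau X" "v \<in> K_tau Y" for u v
    unfolding cost_def \<pi>'_def
    using XY.X.K_tau_measurable[OF that(1)] XY.Y.K_tau_measurable[OF that(2)]
    by (subst integral_distr[OF swap]) (auto simp: case_prod_beta abs_minus_commute)
  \<comment> \<open>Two reals with the same upper bounds are equal.\<close>
  have "D_tau \<pi>' Y X \<le> c \<longleftrightarrow> D_tau \<pi> X Y \<le> c" for c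
    unfolding XY.D_tau_le_iff[OF \<pi>] YX.D_tau_le_iff[OF *] using cost by auto
  then show "D_tau \<pi>' Y X = D_tau \<pi> X Y"
    by (meson order_antisym order_refl)
qed

lemma d_tau_commute:
  assumes "data_pair X Y" shows "d_tau X Y = d_tau Y X"
proof -
  \<comment> \<open>The point types are generic here, so that the inequality can be used in both
    directions.\<close>
  have *: "d_tau Y X \<le> d_tau X Y" if "data_pair X Y" for X :: "'x geom_data" and Y :: "'y geom_data"
  proof -
    interpret XY: data_pair X Y by fact
    interpret YX: data_pair Y X ..
    have "d_tau Y X \<le> D_tau \<pi> X Y" if "\<pi> \<in> couplings X Y" for \<pi>
      using swap_coupling[OF \<open>data_pair X Y\<close> that] YX.d_tau_le_D_tau by metis
    then show ?thesis
      unfolding d_tau_def[of X Y] using XY.product_coupling by (intro cINF_greatest) auto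
  qed
  interpret XY: data_pair X Y by fact
  have "data_pair Y X" ..
  then show ?thesis
    using *[OF assms] *[of Y X] by simp
qed

section \<open>Approximate gluing and the triangle inequality\<close>

text \<open>By Tonelli, a density whose integral over each row is 1 leaves the first marginal of the
  product unchanged. This yields the marginals in the gluing construction.\<close>

lemma distr_density_fst:
  assumes "sigma_finite_measure M" "sigma_finite_measure N"
    and h [measurable]: "h \<in> borel_measurable (M \<Otimes>\<^sub>M N)"
    and one: "AE q in M. (\<integral>\<^sup>+r. h (q, r) \<partial>N) = 1"
  shows "distr (density (M \<Otimes>\<^sub>M N) h) M fst = M"
proof (rule measure_eqI)
  interpret pair_sigma_finite M N
    using assms(1,2) by (simp add: pair_sigma_finite_def)
  fix A assume "A \<in> sets (distr (density (M \<Otimes>\<^sub>M N) h) M fst)"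
  then have A [measurable]: "A \<in> sets M" by simp
  have "emeasure (distr (density (M \<Otimes>\<^sub>M N) h) M fst) A =
      (\<integral>\<^sup>+p. h p * indicator (fst -` A \<inter> space (M \<Otimes>\<^sub>M N)) p \<partial>(M \<Otimes>\<^sub>M N))"
    by (subst emeasure_distr) (auto simp: emeasure_density)
  also have "\<dots> = (\<integral>\<^sup>+p. h p * indicator A (fst p) \<partial>(M \<Otimes>\<^sub>M N))"
    by (intro nn_integral_cong) (auto simp: indicator_def)
  also have "\<dots> = (\<integral>\<^sup>+q. \<integral>\<^sup>+r. h (q, r) * indicator A q \<partial>N \<partial>M)"
    by (subst M2.nn_integral_fst[symmetric]) auto
  also have "\<dots> = (\<integral>\<^sup>+q. (\<integral>\<^sup>+r. h (q, r) \<partial>N) * indicator A q \<partial>M)"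
    by (intro nn_integral_cong nn_integral_multc) auto
  also have "\<dots> = (\<integral>\<^sup>+q. indicator A q \<partial>M)"
    by (rule nn_integral_cong_AE) (use one in auto)
  finally show "emeasure (distr (density (M \<Otimes>\<^sub>M N) h) M fst) A = emeasure M A"
    by simp
qed simp

lemma distr_density_snd:
  assumes "sigma_finite_measure M" "sigma_finite_measure N"
    and h [measurable]: "h \<in> borel_measurable (M \<Otimes>\<^sub>M N)"
    and one: "AE r in N. (\<integral>\<^sup>+q. h (q, r) \<partial>M) = 1"
  shows "distr (density (M \<Otimes>\<^sub>M N) h) N snd = N"
proof (rule measure_eqI)
  interpret pair_sigma_finite M N
    using assms(1,2) by (simp add: pair_sigma_finite_def)
  fix A assume "A \<in> sets (distr (density (M \<Otimes>\<^sub>M N) h) N snd)"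
  then have A [measurable]: "A \<in> sets N" by simp
  have "emeasure (distr (density (M \<Otimes>\<^sub>M N) h) N snd) A =
      (\<integral>\<^sup>+p. h p * indicator (snd -` A \<inter> space (M \<Otimes>\<^sub>M N)) p \<partial>(M \<Otimes>\<^sub>M N))"
    by (subst emeasure_distr) (auto simp: emeasure_density)
  also have "\<dots> = (\<integral>\<^sup>+p. h p * indicator A (snd p) \<partial>(M \<Otimes>\<^sub>M N))"
    by (intro nn_integral_cong) (auto simp: indicator_def)
  also have "\<dots> = (\<integral>\<^sup>+r. \<integral>\<^sup>+q. h (q, r) * indicator A r \<partial>M \<partial>N)"
    by (subst nn_integral_snd[symmetric]) auto
  also have "\<dots> = (\<integral>\<^sup>+r. (\<integral>\<^sup>+q. h (q, r) \<partial>M) * indicator A r \<partial>N)"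
    by (intro nn_integral_cong nn_integral_multc) auto
  also have "\<dots> = (\<integral>\<^sup>+r. indicator A r \<partial>N)"
    by (rule nn_integral_cong_AE) (use one in auto)
  finally show "emeasure (distr (density (M \<Otimes>\<^sub>M N) h) N snd) A = emeasure N A"
    by simp
qed simp

text \<open>
  No disintegration is needed: \<open>Y\<close> is cut into countably many cells of small diameter, and
  \<open>\<pi>\<close> and \<open>\<rho>\<close> are made independent conditionally on the cell of their \<open>Y\<close>-coordinate. The two
  \<open>Y\<close>-coordinates then lie in the same cell, so that they are almost equal.
\<close>

lemma approximate_gluing:
  fixes X :: "'a geom_data" and Y :: "'b geom_data" and Z :: "'c geom_data"
  assumes XY: "data_pair X Y" and YZ: "data_pair Y Z"
    and \<pi>: "\<pi> \<in> couplings X Y" and \<rho>: "\<rho> \<in> couplings Y Z" and "0 < \<delta>"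
  shows "\<exists>\<sigma>\<in>couplings X Z. \<forall>u\<in>K_tau X. \<forall>v\<in>K_tau Y. \<forall>w\<in>K_tau Z.
           cost \<sigma> u w \<le> cost \<pi> u v + cost \<rho> v w + \<delta>"
proof -
  interpret XY: data_pair X Y by fact
  interpret YZ: data_pair Y Z by fact
  interpret XZ: data_pair X Z ..
  interpret \<pi>: prob_space \<pi> using \<pi> by (simp add: XY.coupling_iff)
  interpret \<rho>: prob_space \<rho> using \<rho> by (simp add: YZ.coupling_iff)
  note \<pi>_meas = XY.coupling_measurable[OF \<pi>] and \<rho>_meas = YZ.coupling_measurable[OF \<rho>]
  have coord: "(\<lambda>s. fst (fst s)) \<in> Q \<rightarrow>\<^sub>M prob_meas X" "(\<lambda>s. snd (fst s)) \<in> Q \<rightarrow>\<^sub>M prob_meas Y"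
    "(\<lambda>s. fst (snd s)) \<in> Q \<rightarrow>\<^sub>M prob_meas Y" "(\<lambda>s. snd (snd s)) \<in> Q \<rightarrow>\<^sub>M prob_meas Z"
    if "sets Q = sets (\<pi> \<Otimes>\<^sub>M \<rho>)" for Q
    unfolding measurable_cong_sets[OF that refl]
    by (rule measurable_compose[OF measurable_fst] measurable_compose[OF measurable_snd] \<pi>_meas \<rho>_meas)+
  obtain n :: "'b \<Rightarrow> nat" where n [measurable]: "n \<in> prob_meas Y \<rightarrow>\<^sub>M count_space UNIV"
    and cell: "\<And>y y'. \<lbrakk>y \<in> points Y; y' \<in> points Y; n y = n y'\<rbrakk> \<Longrightarrow> feature_dist Y y y' < \<delta>"
    using XY.Y.countable_partition[OF \<open>0 < \<delta>\<close>] by metis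
  define C where "C k = {y \<in> space (prob_meas Y). n y = k}" for k
  define p where "p k = measure (prob_meas Y) (C k)" for k
  have C [measurable]: "C k \<in> sets (prob_meas Y)" for k
    unfolding C_def by measurable
  \<comment> \<open>Under the product measure both middle coordinates lie in cell \<open>k\<close>
    with mass \<open>p k * p k\<close>; the factor \<open>1 / p k\<close> restores the mass
    \<open>p k\<close> of that cell.\<close>
  define h where "h = (\<lambda>q :: ('a \<times> 'b) \<times> 'b \<times> 'c. if n (snd (fst q)) = n (fst (snd q))
     then ennreal (1 / p (n (snd (fst q)))) else 0)"
  have h [measurable]: "h \<in> borel_measurable (\<pi> \<Otimes>\<^sub>M \<rho>)"
  proof -
    define i j where "i q = n (snd (fst q))" and "j q = n (fst (snd q))" for q :: "('a \<times> 'b) \<times> 'b \<times> 'c"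
    have ij: "i \<in> \<pi> \<Otimes>\<^sub>M \<rho> \<rightarrow>\<^sub>M count_space UNIV" "j \<in> \<pi> \<Otimes>\<^sub>M \<rho> \<rightarrow>\<^sub>M count_space UNIV"
      unfolding i_def j_def by (rule measurable_compose[OF coord(2)[OF refl] n]
        measurable_compose[OF coord(3)[OF refl] n])+
    have "{q \<in> space (\<pi> \<Otimes>\<^sub>M \<rho>). i q = j q} =
        (\<Union>k. (i -` {k} \<inter> space (\<pi> \<Otimes>\<^sub>M \<rho>)) \<inter> (j -` {k} \<inter> space (\<pi> \<Otimes>\<^sub>M \<rho>)))"
      by auto
    also have "\<dots> \<in> sets (\<pi> \<Otimes>\<^sub>M \<rho>)"
      by (intro sets.countable_UN image_subsetI sets.Int measurable_sets[OF ij(1)] measurable_sets[OF ij(2)]) auto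
    finally have eq: "{q \<in> space (\<pi> \<Otimes>\<^sub>M \<rho>). i q = j q} \<in> sets (\<pi> \<Otimes>\<^sub>M \<rho>)" .
    have inv: "(\<lambda>q. ennreal (1 / p (i q))) \<in> borel_measurable (\<pi> \<Otimes>\<^sub>M \<rho>)"
      by (rule measurable_compose[OF ij(1)]) simp
    have "(\<lambda>q. if i q = j q then ennreal (1 / p (i q)) else 0) \<in> borel_measurable (\<pi> \<Otimes>\<^sub>M \<rho>)"
      by (rule measurable_If[OF inv]) (simp_all add: eq)
    then show ?thesis
      unfolding h_def i_def j_def .
  qed
  \<comment> \<open>On cells of mass 0 the quotient \<open>1 / p k\<close> is 0 and the
    normalization fails, but almost no point lies in such a cell.\<close>
  have AE_p: "AE y in prob_meas Y. p (n y) \<noteq> 0"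
  proof -
    have "AE y in prob_meas Y. n y = k \<longrightarrow> p k \<noteq> 0" for k
    proof (cases "p k = 0")
      case True
      then have "emeasure (prob_meas Y) (C k) = 0"
        by (simp add: p_def XY.Y.prob.emeasure_eq_measure)
      then show ?thesis
        by (intro AE_I[of _ _ "C k"]) (auto simp: C_def)
    qed auto
    then have "AE y in prob_meas Y. \<forall>k. n y = k \<longrightarrow> p k \<noteq> 0"
      unfolding AE_all_countable by blast
    then show ?thesis
      by simp
  qed
  have one: "ennreal (1 / p k) * ennreal (p k) = 1" if "p k \<noteq> 0" for k
    using that by (subst ennreal_mult[symmetric]) (auto simp: p_def measure_nonneg)
  have "AE q in \<pi>. p (n (snd q)) \<noteq> 0"
    by (rule XY.coupling_AE_snd[OF \<pi> AE_p])
  \<comment> \<open>For \<open>q\<close> in cell \<open>k\<close>, the density is constant on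
    \<open>C k \<times> points Z\<close>, which has mass \<open>p k\<close> under
    \<open>\<rho>\<close> because both couplings share the middle marginal.\<close>
  then have 1: "AE q in \<pi>. (\<integral>\<^sup>+r. h (q, r) \<partial>\<rho>) = 1"
  proof (eventually_elim)
    case (elim q)
    have "(\<integral>\<^sup>+r. h (q, r) \<partial>\<rho>) =
        (\<integral>\<^sup>+r. ennreal (1 / p (n (snd q))) * indicator (C (n (snd q)) \<times> points Z) r \<partial>\<rho>)"
      by (intro nn_integral_cong) (auto simp: h_def C_def YZ.coupling_space[OF \<rho>] indicator_def)
    also have "\<dots> = ennreal (1 / p (n (snd q))) * emeasure \<rho> (C (n (snd q)) \<times> points Z)"
    proof (rule nn_integral_cmult_indicator)
      have "points Z \<in> sets (prob_meas Z)"
        using sets.top[of "prob_meas Z"] by simp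
      then show "C (n (snd q)) \<times> points Z \<in> sets \<rho>"
        by (simp add: YZ.coupling_sets[OF \<rho>])
    qed
    also have "emeasure \<rho> (C (n (snd q)) \<times> points Z) = ennreal (p (n (snd q)))"
      by (simp add: \<rho>.emeasure_eq_measure YZ.coupling_measure_fst[OF \<rho>] p_def)
    finally show ?case
      using one elim by simp
  qed
  have "AE r in \<rho>. p (n (fst r)) \<noteq> 0"
    by (rule YZ.coupling_AE_fst[OF \<rho> AE_p])
  then have 2: "AE r in \<rho>. (\<integral>\<^sup>+q. h (q, r) \<partial>\<pi>) = 1"
  proof (eventually_elim)
    case (elim r)
    have "(\<integral>\<^sup>+q. h (q, r) \<partial>\<pi>) =
        (\<integral>\<^sup>+q. ennreal (1 / p (n (fst r))) * indicator (points X \<times> C (n (fst r))) q \<partial>\<pi>)"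
      by (intro nn_integral_cong) (auto simp: h_def C_def XY.coupling_space[OF \<pi>] indicator_def)
    also have "\<dots> = ennreal (1 / p (n (fst r))) * emeasure \<pi> (points X \<times> C (n (fst r)))"
    proof (rule nn_integral_cmult_indicator)
      have "points X \<in> sets (prob_meas X)"
        using sets.top[of "prob_meas X"] by simp
      then show "points X \<times> C (n (fst r)) \<in> sets \<pi>"
        by (simp add: XY.coupling_sets[OF \<pi>])
    qed
    also have "emeasure \<pi> (points X \<times> C (n (fst r))) = ennreal (p (n (fst r)))"
      by (simp add: \<pi>.emeasure_eq_measure XY.coupling_measure_snd[OF \<pi>] p_def)
    finally show ?case
      using one elim by simp
  qed
  define S where "S = density (\<pi> \<Otimes>\<^sub>M \<rho>) h"
  have sets_S [measurable_cong]: "sets S = sets (\<pi> \<Otimes>\<^sub>M \<rho>)"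
    by (simp add: S_def)
  have space_S: "space S = (points X \<times> points Y) \<times> points Y \<times> points Z"
    by (simp add: S_def space_pair_measure XY.coupling_space[OF \<pi>] YZ.coupling_space[OF \<rho>])
  have S1: "distr S \<pi> fst = \<pi>" and S2: "distr S \<rho> snd = \<rho>"
    unfolding S_def
    using distr_density_fst[OF _ _ h 1] distr_density_snd[OF _ _ h 2]
      \<pi>.sigma_finite_measure_axioms \<rho>.sigma_finite_measure_axioms by auto
  have m1 [measurable]: "fst \<in> S \<rightarrow>\<^sub>M \<pi>" and m2 [measurable]: "snd \<in> S \<rightarrow>\<^sub>M \<rho>"
    unfolding measurable_cong_sets[OF sets_S refl] by auto
  interpret S: prob_space S
    by (rule prob_space_distrD[OF m1]) (simp add: S1 \<pi>.prob_space_axioms)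
  define g where "g s = (fst (fst s), snd (snd s))" for s :: "('a \<times> 'b) \<times> 'b \<times> 'c"
  have g [measurable]: "g \<in> S \<rightarrow>\<^sub>M prob_meas X \<Otimes>\<^sub>M prob_meas Z"
    unfolding g_def by (rule measurable_Pair coord sets_S)+
  define \<sigma> where "\<sigma> = distr S (prob_meas X \<Otimes>\<^sub>M prob_meas Z) g"
  have AE_S: "AE s in S. n (snd (fst s)) = n (fst (snd s))"
    unfolding S_def AE_density[OF h] by (auto simp: h_def)
  show ?thesis
  proof (intro bexI ballI)
    have "distr \<sigma> (prob_meas X) fst = distr (distr S \<pi> fst) (prob_meas X) fst"
      unfolding \<sigma>_def distr_distr[OF measurable_fst g] distr_distr[OF \<pi>_meas(1) m1]
      by (simp add: g_def o_def)
    moreover have "distr \<sigma> (prob_meas Z) snd = distr (distr S \<rho> snd) (prob_meas Z) snd"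
      unfolding \<sigma>_def distr_distr[OF measurable_snd g] distr_distr[OF \<rho>_meas(2) m2]
      by (simp add: g_def o_def)
    ultimately show "\<sigma> \<in> couplings X Z"
      unfolding XZ.coupling_iff S1 S2 using \<pi> \<rho>
      by (auto simp: XY.coupling_iff YZ.coupling_iff \<sigma>_def intro: S.prob_space_distr)
    fix u v w assume u: "u \<in> K_tau X" and v: "v \<in> K_tau Y" and w: "w \<in> K_tau Z"
    note uvw = XY.X.K_tau_measurable[OF u] XY.Y.K_tau_measurable[OF v] YZ.Y.K_tau_measurable[OF w]
    note [measurable] = measurable_compose[OF coord(1)[OF sets_S] uvw(1)]
      measurable_compose[OF coord(2)[OF sets_S] uvw(2)] measurable_compose[OF coord(3)[OF sets_S] uvw(2)]
      measurable_compose[OF coord(4)[OF sets_S] uvw(3)]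
    have int1: "integrable S (\<lambda>s. \<bar>u (fst (fst s)) - v (snd (fst s))\<bar>)"
      by (rule S.integrable_const_bound[where B=1]) (auto simp: space_S intro!: XY.K_tau_diff_bound u v)
    have int2: "integrable S (\<lambda>s. \<bar>v (fst (snd s)) - w (snd (snd s))\<bar>)"
      by (rule S.integrable_const_bound[where B=1]) (auto simp: space_S intro!: YZ.K_tau_diff_bound v w)
    have "cost \<sigma> u w = (\<integral>s. \<bar>u (fst (fst s)) - w (snd (snd s))\<bar> \<partial>S)"
      unfolding cost_def \<sigma>_def using uvw by (subst integral_distr[OF g]) (auto simp: g_def)
    \<comment> \<open>Triangle inequality through the two middle points: they almost surely share a
      cell, and \<open>v\<close> is 1-Lipschitz, so its two values differ by less than
      \<open>\<delta>\<close>.\<close>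
    also have "\<dots> \<le> (\<integral>s. \<bar>u (fst (fst s)) - v (snd (fst s))\<bar> + \<bar>v (fst (snd s)) - w (snd (snd s))\<bar> + \<delta> \<partial>S)"
    proof (rule integral_mono_AE)
      show "integrable S (\<lambda>s. \<bar>u (fst (fst s)) - w (snd (snd s))\<bar>)"
        by (rule S.integrable_const_bound[where B=1]) (auto simp: space_S intro!: XZ.K_tau_diff_bound u w)
      show "AE s in S. \<bar>u (fst (fst s)) - w (snd (snd s))\<bar> \<le>
          \<bar>u (fst (fst s)) - v (snd (fst s))\<bar> + \<bar>v (fst (snd s)) - w (snd (snd s))\<bar> + \<delta>"
        using AE_S AE_space
      proof eventually_elim
        case (elim s)
        then have "snd (fst s) \<in> points Y" "fst (snd s) \<in> points Y"
          by (auto simp: space_S)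
        then have "\<bar>v (snd (fst s)) - v (fst (snd s))\<bar> < \<delta>"
          using cell elim(1) XY.Y.K_tau_lipschitz[OF v] by fastforce
        then show ?case by linarith
      qed
    qed (use int1 int2 in auto)
    also have "\<dots> = (\<integral>s. \<bar>u (fst (fst s)) - v (snd (fst s))\<bar> \<partial>S) +
        (\<integral>s. \<bar>v (fst (snd s)) - w (snd (snd s))\<bar> \<partial>S) + \<delta>"
      using int1 int2 by (simp add: S.prob_space)
    also have "(\<integral>s. \<bar>u (fst (fst s)) - v (snd (fst s))\<bar> \<partial>S) = cost \<pi> u v"
      unfolding cost_def
      using integral_distr[OF m1 XY.cost_measurable[OF \<pi> u v]] by (simp add: S1)
    also have "(\<integral>s. \<bar>v (fst (snd s)) - w (snd (snd s))\<bar> \<partial>S) = cost \<rho> v w"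
      unfolding cost_def
      using integral_distr[OF m2 YZ.cost_measurable[OF \<rho> v w]] by (simp add: S2)
    finally show "cost \<sigma> u w \<le> cost \<pi> u v + cost \<rho> v w + \<delta>" .
  qed
qed

text \<open>Since \<open>d_tau\<close> is an infimum, gluing up to an error is enough. The tolerance
  is split into thirds: one for each near-optimal coupling and one for the gluing. Partners are then
  chosen in succession through the middle data set.\<close>

lemma d_tau_triangle:
  assumes XY: "data_pair X Y" and YZ: "data_pair Y Z"
  shows "d_tau X Z \<le> d_tau X Y + d_tau Y Z"
proof (rule field_le_epsilon)
  interpret XY: data_pair X Y by fact
  interpret YZ: data_pair Y Z by fact
  interpret XZ: data_pair X Z ..
  fix e :: real assume "0 < e"
  define a where "a = d_tau X Y + e/3"
  define b where "b = d_tau Y Z + e/3"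
  obtain \<pi> where \<pi>: "\<pi> \<in> couplings X Y" "D_tau \<pi> X Y < a"
    using XY.near_optimal_coupling[of a] \<open>0 < e\<close> by (auto simp: a_def)
  obtain \<rho> where \<rho>: "\<rho> \<in> couplings Y Z" "D_tau \<rho> Y Z < b"
    using YZ.near_optimal_coupling[of b] \<open>0 < e\<close> by (auto simp: b_def)
  obtain \<sigma> where \<sigma>: "\<sigma> \<in> couplings X Z" and glue: "\<And>u v w. \<lbrakk>u \<in> K_tau X; v \<in> K_tau Y; w \<in> K_tau Z\<rbrakk>
      \<Longrightarrow> cost \<sigma> u w \<le> cost \<pi> u v + cost \<rho> v w + e/3"
    using approximate_gluing[OF XY YZ \<pi>(1) \<rho>(1), of "e/3"] \<open>0 < e\<close> by auto
  note le = XY.D_tau_le_iff[OF \<pi>(1), THEN iffD1, OF less_imp_le[OF \<pi>(2)]]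
    YZ.D_tau_le_iff[OF \<rho>(1), THEN iffD1, OF less_imp_le[OF \<rho>(2)]]
  have "D_tau \<sigma> X Z \<le> a + b + e/3"
    unfolding XZ.D_tau_le_iff[OF \<sigma>]
  proof (intro conjI ballI allI impI)
    fix u and c :: real assume u: "u \<in> K_tau X" and "0 < c"
    then obtain v where v: "v \<in> K_tau Y" "cost \<pi> u v < a + c/2"
      using le(1) half_gt_zero by blast
    then obtain w where w: "w \<in> K_tau Z" "cost \<rho> v w < b + c/2"
      using le(2) \<open>0 < c\<close> half_gt_zero by blast
    show "\<exists>w\<in>K_tau Z. cost \<sigma> u w < a + b + e/3 + c"
      using glue[OF u v(1) w(1)] v w by (intro bexI[of _ w]) auto
  next
    fix w and c :: real assume w: "w \<in> K_tau Z" and "0 < c"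
    then obtain v where v: "v \<in> K_tau Y" "cost \<rho> v w < b + c/2"
      using le(2) half_gt_zero by blast
    then obtain u where u: "u \<in> K_tau X" "cost \<pi> u v < a + c/2"
      using le(1) \<open>0 < c\<close> half_gt_zero by blast
    show "\<exists>u\<in>K_tau X. cost \<sigma> u w < a + b + e/3 + c"
      using glue[OF u(1) v(1) w] v u by (intro bexI[of _ u]) auto
  qed
  then have "d_tau X Z \<le> a + b + e/3"
    using XZ.d_tau_le_D_tau[OF \<sigma>] by linarith
  then show "d_tau X Z \<le> d_tau X Y + d_tau Y Z + e"
    by (simp add: a_def b_def)
qed

section \<open>Tightness and finitely additive set functions\<close>

text \<open>The weights sum to \<open>2 * e\<close>. Callers start from a quarter of their
  tolerance, which leaves room for a strict inequality.\<close>

lemma (in finite_measure) measure_UN_geometric: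
  fixes A :: "nat \<Rightarrow> 'a set"
  assumes A: "\<And>i. A i \<in> sets M" and le: "\<And>i. measure M (A i) \<le> e * (1/2) ^ i"
  shows "measure M (\<Union>i. A i) \<le> 2 * e"
proof -
  have geo: "(\<lambda>i. e * (1/2) ^ i) sums (2 * e)"
    using sums_mult[OF geometric_sums[of "1/2 :: real"], of e] by (simp add: mult.commute)
  have summ: "summable (\<lambda>i. measure M (A i))"
    by (rule summable_comparison_test'[OF sums_summable[OF geo], of 0]) (use le in auto)
  have "measure M (\<Union>i. A i) \<le> (\<Sum>i. measure M (A i))"
    using A summ by (intro finite_measure_subadditive_countably) auto
  also have "\<dots> \<le> (\<Sum>i. e * (1/2) ^ i)"
    by (intro suminf_le le summ sums_summable[OF geo])
  also have "\<dots> = 2 * e"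
    using geo by (simp add: sums_iff)
  finally show ?thesis .
qed

section \<open>Regularity and tightness of the measure\<close>

context data_set
begin

lemma points_sets [measurable]: "points X \<in> sets (prob_meas X)"
  using sets.top[of "prob_meas X"] by simp

text \<open>Induction over the generation of Borel sets. Open sets are increasing unions of closed
  sets in a metric space; approximating from both sides at once makes the property stable under
  complements.\<close>

lemma closed_open_regular:
  assumes "A \<in> sets (prob_meas X)" and "0 < e"
  shows "\<exists>C U. closedin met.mtopology C \<and> openin met.mtopology U \<and> C \<subseteq> A \<and> A \<subseteq> U \<and> prob.prob (U - C) < e"
proof -
  have "A \<in> sigma_sets (points X) {U. openin met.mtopology U}"
    using assms(1) by (simp add: sets_eq borel_sets_def)
  then show ?thesis
    using \<open>0 < e\<close>
  proof (induction arbitrary: e rule: sigma_sets.induct)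
    case (Basic U)
    then have U: "openin met.mtopology U" by simp
    then have "fsigma_in met.mtopology U"
      by (intro open_imp_fsigma_in met.metrizable_space_mtopology)
    then obtain C where C: "\<And>n. closedin met.mtopology (C n)" "\<And>n. C n \<subseteq> C (Suc n)" "(\<Union>n. C n) = U"
      unfolding fsigma_in_ascending by blast
    have mono: "C m \<subseteq> C n" if "m \<le> n" for m n
      using C(2) that by (rule lift_Suc_mono_le)
    have "\<exists>n. prob.prob (U - C n) < e"
    proof (rule prob.decseq_measure_less)
      have "(\<Inter>n. U - C n) = {}"
        using C(3) by blast
      then show "prob.prob (\<Inter>n. U - C n) < e"
        using Basic.prems by (simp del: INT_simps)
      show "U - C n \<in> prob.events" for n
        using U C(1) by auto
      show "U - C j \<subseteq> U - C i" if "i \<le> j" for i j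
        using mono[OF that] by blast
    qed
    then obtain n where "prob.prob (U - C n) < e" ..
    then show ?case
      using U C by (intro exI[of _ "C n"] exI[of _ U]) auto
  next
    case Empty
    then show ?case
      by (intro exI[of _ "{}"]) auto
  next
    case (Compl A)
    then obtain C U where CU: "closedin met.mtopology C" "openin met.mtopology U" "C \<subseteq> A" "A \<subseteq> U"
        "prob.prob (U - C) < e"
      by meson
    have "(points X - C) - (points X - U) = U - C"
      using openin_subset[OF CU(2)] by auto
    with CU show ?case
      by (intro exI[of _ "points X - U"] exI[of _ "points X - C"]) (auto simp: openin_diff closedin_diff)
  next
    case (Union A)
    have "\<forall>i. \<exists>C U. closedin met.mtopology C \<and> openin met.mtopology U \<and> C \<subseteq> A i \<and> A i \<subseteq> U \<and>
        prob.prob (U - C) < e/4 * (1/2) ^ i"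
    proof
      fix i
      have "0 < e/4 * (1/2) ^ i"
        using Union.prems by simp
      then show "\<exists>C U. closedin met.mtopology C \<and> openin met.mtopology U \<and> C \<subseteq> A i \<and> A i \<subseteq> U \<and>
          prob.prob (U - C) < e/4 * (1/2) ^ i"
        by (rule Union.IH)
    qed
    then obtain C U where C: "\<And>i. closedin met.mtopology (C i)" and U: "\<And>i. openin met.mtopology (U i)"
      and sub: "\<And>i. C i \<subseteq> A i" "\<And>i. A i \<subseteq> U i"
      and lt: "\<And>i. prob.prob (U i - C i) < e/4 * (1/2) ^ i"
      by metis
    \<comment> \<open>A countable union of closed sets need not be closed, so only the first
      \<open>n\<close> are kept. The errors \<open>D n\<close> decrease to a set covered by the
      differences \<open>U i - C i\<close>, which have total mass at most
      \<open>e/2\<close>.\<close>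
    define D where "D n = (\<Union>i. U i) - (\<Union>i\<le>n. C i)" for n
    have [measurable]: "U i \<in> prob.events" "C i \<in> prob.events" for i
      using U C by auto
    have "\<exists>n. prob.prob (D n) < e"
    proof (rule prob.decseq_measure_less)
      show "D n \<in> prob.events" for n
        unfolding D_def by measurable
      show "D j \<subseteq> D i" if "i \<le> j" for i j
        using that by (fastforce simp: D_def)
      have "prob.prob (\<Inter>n. D n) \<le> prob.prob (\<Union>i. U i - C i)"
        by (intro prob.finite_measure_mono) (auto simp: D_def)
      also have "\<dots> \<le> 2 * (e/4)"
        by (intro prob.measure_UN_geometric less_imp_le lt) auto
      finally show "prob.prob (\<Inter>n. D n) < e"
        using Union.prems by simp
    qed
    then obtain n where "prob.prob (D n) < e" ..
    then show ?case
      using sub C U unfolding D_def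
      by (intro exI[of _ "\<Union>i\<le>n. C i"] exI[of _ "\<Union>i. U i"] conjI)
         (auto intro!: closedin_Union openin_Union, blast+)
  qed
qed

text \<open>Ulam's theorem. For each radius \<open>1 / Suc n\<close>, finitely many closed balls
  cover all but a geometrically small mass; the intersection of these finite unions is closed and
  totally bounded, hence compact by completeness.\<close>

lemma tight:
  assumes "0 < e"
  shows "\<exists>C. compactin met.mtopology C \<and> prob.prob (points X - C) < e"
proof -
  obtain s :: "nat \<Rightarrow> 'a" where s: "\<And>i. s i \<in> points X"
    "\<And>x e. \<lbrakk>x \<in> points X; 0 < e\<rbrakk> \<Longrightarrow> \<exists>i. feature_dist X x (s i) < e"
    using dense_sequence by metis
  define B where "B n k = (\<Union>i\<le>k. met.mcball (s i) (1 / Suc n))" for n k :: nat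
  have B: "closedin met.mtopology (B n k)" for n k
    unfolding B_def by (intro closedin_Union) auto
  note [measurable] = closed_sets[OF B]
  have "\<exists>k. prob.prob (points X - B n k) < e/4 * (1/2) ^ n" for n
  proof (rule prob.decseq_measure_less)
    show "points X - B n k \<in> prob.events" for k
      by measurable
    show "points X - B n j \<subseteq> points X - B n i" if "i \<le> j" for i j
      using that by (fastforce simp: B_def)
    have "\<exists>k. x \<in> B n k" if x: "x \<in> points X" for x
    proof -
      obtain i where "feature_dist X x (s i) < 1 / Suc n"
        using s(2)[OF x, of "1 / Suc n"] by auto
      then have "x \<in> met.mcball (s i) (1 / Suc n)"
        using x s(1) by (simp add: met.commute)
      then show ?thesis
        unfolding B_def by blast
    qed
    then have "(\<Inter>k. points X - B n k) = {}"
      by blast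
    then show "prob.prob (\<Inter>k. points X - B n k) < e/4 * (1/2) ^ n"
      using assms by (simp del: INT_simps)
  qed
  then obtain k where k: "\<And>n. prob.prob (points X - B n (k n)) < e/4 * (1/2) ^ n"
    by metis
  define C where "C = (\<Inter>n. B n (k n))"
  have closed: "closedin met.mtopology C"
    unfolding C_def using B by (intro closedin_Inter) auto
  then have sub: "C \<subseteq> points X"
    using closedin_subset by force
  have "met.mtotally_bounded C"
    unfolding met.mtotally_bounded_def
  proof (intro allI impI)
    fix \<epsilon> :: real assume "0 < \<epsilon>"
    then obtain n where n: "1 / Suc n < \<epsilon> / 2"
      using nat_approx_posE[of "\<epsilon>/2"] by auto
    \<comment> \<open>Total boundedness asks for centres inside \<open>C\<close>, so each ball that
      meets \<open>C\<close> gets a centre there. This doubles the radius, hence the choice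
      \<open>1 / Suc n < \<epsilon> / 2\<close>.\<close>
    define I where "I = {i. i \<le> k n \<and> C \<inter> met.mcball (s i) (1 / Suc n) \<noteq> {}}"
    have "\<forall>i\<in>I. \<exists>c. c \<in> C \<and> c \<in> met.mcball (s i) (1 / Suc n)"
      by (auto simp: I_def)
    then obtain c where c: "\<And>i. i \<in> I \<Longrightarrow> c i \<in> C" "\<And>i. i \<in> I \<Longrightarrow> c i \<in> met.mcball (s i) (1 / Suc n)"
      by metis
    have "C \<subseteq> (\<Union>x\<in>c ` I. met.mball x \<epsilon>)"
    proof
      fix x assume x: "x \<in> C"
      then have "x \<in> B n (k n)"
        by (auto simp: C_def)
      then obtain i where i: "i \<le> k n" "x \<in> met.mcball (s i) (1 / Suc n)"
        unfolding B_def by blast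
      then have iI: "i \<in> I"
        using x unfolding I_def by blast
      have "feature_dist X (c i) x \<le> feature_dist X (s i) (c i) + feature_dist X (s i) x"
        using x c(1)[OF iI] s(1) sub by (intro met.triangle'') auto
      also have "\<dots> < \<epsilon>"
        using i(2) c(2)[OF iI] n by auto
      finally have "x \<in> met.mball (c i) \<epsilon>"
        using x c(1)[OF iI] sub by auto
      then show "x \<in> (\<Union>x\<in>c ` I. met.mball x \<epsilon>)"
        using iI by blast
    qed
    moreover have "finite (c ` I)" "c ` I \<subseteq> C"
      using c(1) by (auto simp: I_def)
    ultimately show "\<exists>K. finite K \<and> K \<subseteq> C \<and> C \<subseteq> (\<Union>x\<in>K. met.mball x \<epsilon>)"
      by blast
  qed
  then have "compactin met.mtopology C"
    using met.mtotally_bounded_eq_compact_closure_of[OF mcomplete, of C] closed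
    by (simp add: closure_of_closedin)
  moreover have "prob.prob (points X - C) < e"
  proof -
    have "points X - C = (\<Union>n. points X - B n (k n))"
      by (auto simp: C_def)
    also have "prob.prob \<dots> \<le> 2 * (e/4)"
      by (intro prob.measure_UN_geometric less_imp_le k) auto
    finally show ?thesis
      using assms by simp
  qed
  ultimately show ?thesis
    by blast
qed

text \<open>A closed inner approximation is intersected with a compact set of almost full mass; each
  contributes half of the error.\<close>

lemma compact_inner_regular:
  assumes A [measurable]: "A \<in> sets (prob_meas X)" and "0 < e"
  shows "\<exists>C. compactin met.mtopology C \<and> C \<subseteq> A \<and> prob.prob (A - C) < e"
proof -
  obtain C U where C: "closedin met.mtopology C" "C \<subseteq> A" and U: "openin met.mtopology U" "A \<subseteq> U"
    and UC: "prob.prob (U - C) < e/2"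
    using closed_open_regular[OF A, of "e/2"] \<open>0 < e\<close> by auto
  obtain K where K: "compactin met.mtopology K" "prob.prob (points X - K) < e/2"
    using tight[of "e/2"] \<open>0 < e\<close> by auto
  have [measurable]: "C \<in> prob.events" "U \<in> prob.events" "K \<in> prob.events"
    using C(1) U(1) compactin_imp_closedin[OF met.Hausdorff_space_mtopology K(1)] by auto
  have "prob.prob (A - C \<inter> K) \<le> prob.prob ((U - C) \<union> (points X - K))"
    using U C openin_subset[OF U(1)] by (intro prob.finite_measure_mono) auto
  also have "\<dots> \<le> prob.prob (U - C) + prob.prob (points X - K)"
    by (intro measure_Un_le) auto
  finally have "prob.prob (A - C \<inter> K) < e"
    using UC K(2) by simp
  moreover have "compactin met.mtopology (C \<inter> K)"
    by (intro closed_Int_compactin C K)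
  ultimately show ?thesis
    using C(2) by blast
qed

end

text \<open>Inner regularity on a single set, phrased for a bare set function because a setwise
  limit of couplings is not yet known to be a measure.\<close>

definition compact_inner :: "'a topology \<Rightarrow> ('a set \<Rightarrow> real) \<Rightarrow> 'a set \<Rightarrow> bool" where
  "compact_inner T l C \<longleftrightarrow> (\<forall>e>0. \<exists>K. compactin T K \<and> K \<subseteq> C \<and> l (C - K) < e)"

text \<open>Setwise limits of measures keep nonnegativity and additivity but may lose countable
  additivity. \<open>N\<close> provides the sigma-algebra, \<open>T\<close> the compact
  sets.\<close>

locale finitely_additive =
  fixes T :: "'a topology" and N :: "'a measure" and l :: "'a set \<Rightarrow> real"
  assumes Hausdorff: "Hausdorff_space T"
    and space: "space N = topspace T" and sets: "sets N = borel_sets T"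
    and nonneg: "0 \<le> l C"
    and additive: "\<lbrakk>C \<in> sets N; D \<in> sets N; C \<inter> D = {}\<rbrakk> \<Longrightarrow> l (C \<union> D) = l C + l D"
begin

lemma empty: "l {} = 0"
  using additive[of "{}" "{}"] by simp

lemma mono:
  assumes "C \<in> sets N" "D \<in> sets N" "C \<subseteq> D"
  shows "l C \<le> l D"
  using additive[of C "D - C"] nonneg[of "D - C"] assms by (simp add: Un_absorb1)

lemma subadditive:
  assumes "C \<in> sets N" "D \<in> sets N"
  shows "l (C \<union> D) \<le> l C + l D"
  using additive[of C "D - C"] mono[of "D - C" D] assms by simp

lemma subadditive_finite:
  assumes "finite I" "\<And>i. i \<in> I \<Longrightarrow> C i \<in> sets N"
  shows "l (\<Union>i\<in>I. C i) \<le> (\<Sum>i\<in>I. l (C i))"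
  using assms
proof (induction rule: finite_induct)
  case (insert i I)
  have "l (C i \<union> (\<Union>i\<in>I. C i)) \<le> l (C i) + l (\<Union>i\<in>I. C i)"
    using insert by (intro subadditive) auto
  then show ?case
    using insert by force
qed (simp add: empty)

lemma compact_sets: "compactin T K \<Longrightarrow> K \<in> sets N"
  using compactin_imp_closedin[OF Hausdorff] by (simp add: sets closedin_borel_sets)

text \<open>What remains of the union is covered by what remains of the two parts. The same cover
  serves for intersections, and both facts together make the sets approximable along with their
  complements an algebra.\<close>

lemma compact_inner_Un:
  assumes C: "C \<in> sets N" "compact_inner T l C" and D: "D \<in> sets N" "compact_inner T l D"
  shows "compact_inner T l (C \<union> D)"
  unfolding compact_inner_def
proof (intro allI impI)
  fix e :: real assume "0 < e"
  then obtain K L where K: "compactin T K" "K \<subseteq> C" "l (C - K) < e/2"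
    and L: "compactin T L" "L \<subseteq> D" "l (D - L) < e/2"
    using C(2) D(2) unfolding compact_inner_def by (meson half_gt_zero)
  note [measurable] = C(1) D(1) compact_sets[OF K(1)] compact_sets[OF L(1)]
  have "l (C \<union> D - (K \<union> L)) \<le> l ((C - K) \<union> (D - L))"
    by (intro mono) auto
  also have "\<dots> \<le> l (C - K) + l (D - L)"
    by (intro subadditive) auto
  finally show "\<exists>K. compactin T K \<and> K \<subseteq> C \<union> D \<and> l (C \<union> D - K) < e"
    using K L by (intro exI[of _ "K \<union> L"]) (auto intro: compactin_Un)
qed

lemma compact_inner_Int:
  assumes C: "C \<in> sets N" "compact_inner T l C" and D: "D \<in> sets N" "compact_inner T l D"
  shows "compact_inner T l (C \<inter> D)"
  unfolding compact_inner_def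
proof (intro allI impI)
  fix e :: real assume "0 < e"
  then obtain K L where K: "compactin T K" "K \<subseteq> C" "l (C - K) < e/2"
    and L: "compactin T L" "L \<subseteq> D" "l (D - L) < e/2"
    using C(2) D(2) unfolding compact_inner_def by (meson half_gt_zero)
  note [measurable] = C(1) D(1) compact_sets[OF K(1)] compact_sets[OF L(1)]
  have "l (C \<inter> D - K \<inter> L) \<le> l ((C - K) \<union> (D - L))"
    by (intro mono) auto
  also have "\<dots> \<le> l (C - K) + l (D - L)"
    by (intro subadditive) auto
  finally show "\<exists>K. compactin T K \<and> K \<subseteq> C \<inter> D \<and> l (C \<inter> D - K) < e"
    using K L compactin_imp_closedin[OF Hausdorff K(1)]
    by (intro exI[of _ "K \<inter> L"]) (auto intro: closed_Int_compactin)
qed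

text \<open>
  Compact inner approximability makes \<open>l\<close> continuous at the empty set, by the finite intersection
  property.
\<close>

lemma continuous_at_empty:
  assumes A: "\<And>i. A i \<in> sets N" "\<And>i. compact_inner T l (A i)" and dec: "decseq A" and "(\<Inter>i. A i) = {}"
  shows "(\<lambda>i. l (A i)) \<longlonglongrightarrow> 0"
proof (rule tendstoI)
  fix e :: real assume "0 < e"
  have "\<forall>i. \<exists>K. compactin T K \<and> K \<subseteq> A i \<and> l (A i - K) < e/4 * (1/2) ^ i"
  proof
    fix i
    have "0 < e/4 * (1/2) ^ i"
      using \<open>0 < e\<close> by simp
    then show "\<exists>K. compactin T K \<and> K \<subseteq> A i \<and> l (A i - K) < e/4 * (1/2) ^ i"
      using A(2)[of i] unfolding compact_inner_def by blast
  qed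
  then obtain K where K: "\<And>i. compactin T (K i)" "\<And>i. K i \<subseteq> A i" "\<And>i. l (A i - K i) < e/4 * (1/2) ^ i"
    by metis
  have clo: "closedin T (K i)" for i
    using compactin_imp_closedin[OF Hausdorff K(1)] .
  have "\<exists>n. (\<Inter>i\<le>n. K i) = {}"
  proof (rule ccontr)
    assume ne: "\<not> (\<exists>n. (\<Inter>i\<le>n. K i) = {})"
    \<comment> \<open>All \<open>K i\<close> are closed, so the finite intersection property can be
      applied inside the compact set \<open>K 0\<close>.\<close>
    have "K 0 \<inter> \<Inter>(range K) \<noteq> {}"
    proof (rule compactin_fip[THEN iffD1, OF K(1)[of 0], THEN conjunct2, rule_format], intro conjI allI impI ballI)
      fix \<F> assume "finite \<F> \<and> \<F> \<subseteq> range K"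
      then obtain J where J: "finite J" "\<F> = K ` J"
        by (meson finite_subset_image)
      have "i \<le> Max (insert 0 J)" if "i \<in> insert 0 J" for i
        using J(1) that by (intro Max_ge) auto
      then have "(\<Inter>i\<le>Max (insert 0 J). K i) \<subseteq> K 0 \<inter> \<Inter>\<F>"
        unfolding J(2) by blast
      then show "K 0 \<inter> \<Inter>\<F> \<noteq> {}"
        using ne by blast
    qed (use clo in auto)
    then obtain x where "\<And>i. x \<in> K i"
      by blast
    then have "x \<in> (\<Inter>i. A i)"
      using K(2) by blast
    then show False
      using assms(4) by simp
  qed
  then obtain n where n: "(\<Inter>i\<le>n. K i) = {}" ..
  have "l (A m) < e" if "n \<le> m" for m
  proof -
    \<comment> \<open>A point of \<open>A m\<close> lies in every \<open>A i\<close> with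
      \<open>i \<le> n\<close>, but outside some \<open>K i\<close>. The errors then add up to less
      than \<open>e/2\<close>.\<close>
    have "A m \<subseteq> (\<Union>i\<in>{..n}. A i - K i)"
    proof
      fix x assume "x \<in> A m"
      then have "x \<in> A i" if "i \<le> n" for i
        using dec \<open>n \<le> m\<close> that unfolding decseq_def by (meson order_trans subsetD)
      then show "x \<in> (\<Union>i\<in>{..n}. A i - K i)"
        using n by auto
    qed
    then have "l (A m) \<le> l (\<Union>i\<in>{..n}. A i - K i)"
      using A(1) compact_sets[OF K(1)] by (intro mono) auto
    also have "\<dots> \<le> (\<Sum>i\<le>n. l (A i - K i))"
      using A(1) compact_sets[OF K(1)] by (intro subadditive_finite) auto
    also have "\<dots> \<le> (\<Sum>i\<le>n. e/4 * (1/2) ^ i)"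
      by (intro sum_mono less_imp_le K(3))
    also have "\<dots> = e/4 * (\<Sum>i<Suc n. (1/2) ^ i)"
      by (simp add: sum_distrib_left lessThan_Suc_atMost)
    also have "\<dots> = e/2 * (1 - (1/2) ^ Suc n)"
      by (subst sum_gp_strict) auto
    also have "\<dots> < e/2 * 2"
      using \<open>0 < e\<close> zero_less_power[of "1/2 :: real" "Suc n"] by (intro mult_strict_left_mono) linarith+
    finally show ?thesis by simp
  qed
  then show "eventually (\<lambda>i. dist (l (A i)) 0 < e) sequentially"
    using nonneg by (auto simp: eventually_sequentially)
qed

text \<open>Approximability does not pass to complements by itself, so it is assumed for the
  generators and their complements. The sets with both properties form an algebra on which
  \<open>l\<close> is continuous at the empty set, and Caratheodory's theorem applies to it.\<close>

lemma extension:
  assumes "G \<noteq> {}" and G: "G \<subseteq> sets N" "sigma_sets (space N) G = sets N"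
    and inner: "\<And>C. C \<in> G \<Longrightarrow> compact_inner T l C" "\<And>C. C \<in> G \<Longrightarrow> compact_inner T l (space N - C)"
  shows "\<exists>M. sets M = sets N \<and> (\<forall>C\<in>G. emeasure M C = ennreal (l C))"
proof -
  define \<A> where "\<A> = {C \<in> sets N. compact_inner T l C \<and> compact_inner T l (space N - C)}"
  have "algebra (space N) \<A>"
    unfolding algebra_iff_Un
  proof (intro conjI ballI)
    show "\<A> \<subseteq> Pow (space N)"
      using sets.sets_into_space by (auto simp: \<A>_def)
    show "space N - a \<in> \<A>" if "a \<in> \<A>" for a
      using that sets.sets_into_space[of a N] by (auto simp: \<A>_def double_diff)
    show Un: "a \<union> b \<in> \<A>" if "a \<in> \<A>" "b \<in> \<A>" for a b
      using that by (auto simp: \<A>_def Diff_Un intro!: compact_inner_Un compact_inner_Int)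
    \<comment> \<open>The complement is the whole space, approximable as the union of some generator
      and its complement; this is where \<open>G\<close> must be nonempty.\<close>
    show "{} \<in> \<A>"
    proof -
      obtain C where C: "C \<in> G"
        using \<open>G \<noteq> {}\<close> by auto
      then have "C \<in> sets N"
        using G by auto
      then have "compact_inner T l (C \<union> (space N - C))"
        using C inner by (intro compact_inner_Un) auto
      then have "compact_inner T l (space N)"
        using sets.sets_into_space[OF \<open>C \<in> sets N\<close>] by (simp add: Un_absorb1)
      moreover have "compact_inner T l {}"
        unfolding compact_inner_def using empty by (auto intro!: exI[of _ "{}"])
      ultimately show ?thesis
        by (simp add: \<A>_def)
    qed
  qed
  then interpret \<A>: algebra "space N" \<A> .
  have "\<exists>\<mu>. (\<forall>s\<in>\<A>. \<mu> s = ennreal (l s)) \<and> measure_space (space N) (sigma_sets (space N) \<A>) \<mu>"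
  proof (rule \<A>.caratheodory_empty_continuous)
    show "positive \<A> (\<lambda>C. ennreal (l C))"
      by (simp add: positive_def empty)
    show "additive \<A> (\<lambda>C. ennreal (l C))"
      unfolding additive_def \<A>_def by (auto simp: additive nonneg ennreal_plus[symmetric] simp del: ennreal_plus)
    show "(\<lambda>i. ennreal (l (A i))) \<longlonglongrightarrow> 0"
      if "range A \<subseteq> \<A>" "decseq A" "(\<Inter>i. A i) = {}" for A
    proof -
      have "(\<lambda>i. l (A i)) \<longlonglongrightarrow> 0"
        using that by (intro continuous_at_empty) (auto simp: \<A>_def)
      then show ?thesis
        using tendsto_ennrealI by fastforce
    qed
  qed auto
  then obtain \<mu> where \<mu>: "\<And>s. s \<in> \<A> \<Longrightarrow> \<mu> s = ennreal (l s)"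
      "measure_space (space N) (sigma_sets (space N) \<A>) \<mu>"
    by blast
  have "sigma_sets (space N) \<A> \<subseteq> sets N"
    by (intro sets.sigma_sets_subset) (auto simp: \<A>_def)
  moreover have GA: "G \<subseteq> \<A>"
    using G inner by (auto simp: \<A>_def)
  then have "sets N \<subseteq> sigma_sets (space N) \<A>"
    unfolding G(2)[symmetric] by (rule sigma_sets_mono')
  ultimately have eq: "sigma_sets (space N) \<A> = sets N"
    by auto
  show ?thesis
  proof (intro exI[of _ "measure_of (space N) (sets N) \<mu>"] conjI ballI)
    fix C assume "C \<in> G"
    then show "emeasure (measure_of (space N) (sets N) \<mu>) C = ennreal (l C)"
      using \<mu> G GA unfolding eq measure_space_def
      by (subst emeasure_measure_of_sigma) (auto simp: subset_eq)
  qed simp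
qed

end

text \<open>Tychonoff's theorem for the cube of all functions into the unit interval. A filter takes
  the place of a subsequence, since a cube with so many coordinates need not be sequentially
  compact.\<close>

lemma pointwise_cluster_filter:
  fixes m :: "nat \<Rightarrow> 's \<Rightarrow> real"
  assumes "\<And>n s. 0 \<le> m n s" "\<And>n s. m n s \<le> 1"
  shows "\<exists>l G. G \<noteq> bot \<and> G \<le> sequentially \<and> (\<forall>s. ((\<lambda>n. m n s) \<longlongrightarrow> l s) G)"
proof -
  have "compactin (product_topology (\<lambda>s::'s. euclideanreal) UNIV) (PiE UNIV (\<lambda>_. {0..1}))"
    by (subst compactin_PiE) auto
  then have "compact (PiE (UNIV :: 's set) (\<lambda>_. {0..1::real}))"
    by (simp add: euclidean_product_topology)
  moreover have "filtermap m sequentially \<noteq> bot"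
    by (simp add: filtermap_bot_iff)
  moreover have "eventually (\<lambda>f. f \<in> PiE UNIV (\<lambda>_. {0..1})) (filtermap m sequentially)"
    using assms by (auto simp: eventually_filtermap PiE_UNIV_domain)
  ultimately obtain l where l: "inf (nhds l) (filtermap m sequentially) \<noteq> bot"
    unfolding compact_filter by blast
  \<comment> \<open>Neighbourhoods of the cluster point \<open>l\<close>, pulled back to indices.
    That they meet every tail is exactly what being a cluster point means.\<close>
  define G where "G = inf sequentially (filtercomap m (nhds l))"
  have "G \<noteq> bot"
  proof
    assume "G = bot"
    then have "eventually (\<lambda>_. False) G" by simp
    then obtain P Q where P: "eventually P sequentially" "eventually Q (nhds l)" "\<And>n. P n \<Longrightarrow> Q (m n) \<Longrightarrow> False"
      unfolding G_def eventually_inf eventually_filtercomap by blast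
    then have "eventually (\<lambda>f. \<not> Q f) (filtermap m sequentially)"
      unfolding eventually_filtermap by (blast intro: eventually_mono)
    with P(2) have "eventually (\<lambda>_. False) (inf (nhds l) (filtermap m sequentially))"
      unfolding eventually_inf by blast
    with l show False by (simp add: eventually_False)
  qed
  moreover have "((\<lambda>n. m n s) \<longlongrightarrow> l s) G" for s
  proof -
    have "filterlim m (nhds l) G"
      unfolding G_def by (rule filterlim_mono[OF filterlim_filtercomap order_refl]) simp
    from continuous_on_tendsto_compose[OF continuous_on_product_coordinates this]
    show ?thesis by simp
  qed
  ultimately show ?thesis
    unfolding G_def by (metis inf_le1)
qed

section \<open>Optimal couplings\<close>

text \<open>If every limit exceeded \<open>a\<close>, then so would eventually all of the finitely
  many values at once. A winner that varies with \<open>n\<close> is thereby replaced by a fixed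
  one.\<close>

lemma finite_net_limit:
  fixes f :: "'n \<Rightarrow> 'w \<Rightarrow> real"
  assumes "G \<noteq> bot" "finite N" "\<And>w. w \<in> N \<Longrightarrow> ((\<lambda>n. f n w) \<longlongrightarrow> g w) G"
    and "eventually (\<lambda>n. \<exists>w\<in>N. f n w < a) G"
  shows "\<exists>w\<in>N. g w \<le> a"
proof (rule ccontr)
  assume "\<not> (\<exists>w\<in>N. g w \<le> a)"
  then have "\<forall>w\<in>N. eventually (\<lambda>n. a < f n w) G"
    using assms(3) by (force intro: order_tendstoD)
  then have "eventually (\<lambda>n. \<forall>w\<in>N. a < f n w) G"
    using assms(2) by (intro eventually_ball_finite) auto
  with assms(4) have "eventually (\<lambda>_. False) G"
    by eventually_elim (meson less_asym)
  then show False
    using assms(1) by (simp add: eventually_False)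
qed

section \<open>Continuity of the cost and compactness of couplings\<close>

context data_pair
begin

abbreviation prod_top :: "('a \<times> 'b) topology" where
  "prod_top \<equiv> prod_topology X.met.mtopology Y.met.mtopology"

text \<open>The error is an integral against the marginal alone, so it is the same for all
  couplings.\<close>

lemma cost_diff_right:
  assumes \<pi>: "\<pi> \<in> couplings X Y" and "u \<in> K_tau X" "v \<in> K_tau Y" "w \<in> K_tau Y"
  shows "cost \<pi> u w \<le> cost \<pi> u v + (\<integral>y. \<bar>v y - w y\<bar> \<partial>prob_meas Y)"
proof -
  interpret \<pi>: prob_space \<pi> using \<pi> by (simp add: coupling_iff)
  have m: "(\<lambda>y. \<bar>v y - w y\<bar>) \<in> borel_measurable (prob_meas Y)"
    using Y.K_tau_measurable assms by (intro borel_measurable_abs borel_measurable_diff) auto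
  have int: "integrable \<pi> (\<lambda>p. \<bar>v (snd p) - w (snd p)\<bar>)"
    using measurable_compose[OF coupling_measurable(2)[OF \<pi>] m]
    by (intro \<pi>.integrable_const_bound[where B=1])
       (auto simp: coupling_space[OF \<pi>] intro!: Y.K_tau_diff_bound assms)
  have "cost \<pi> u w \<le> (\<integral>p. \<bar>u (fst p) - v (snd p)\<bar> + \<bar>v (snd p) - w (snd p)\<bar> \<partial>\<pi>)"
    unfolding cost_def
    by (intro integral_mono Bochner_Integration.integrable_add cost_integrable int assms) linarith
  also have "\<dots> = cost \<pi> u v + (\<integral>y. \<bar>v y - w y\<bar> \<partial>prob_meas Y)"
    unfolding cost_def coupling_integral_snd[OF \<pi> m, symmetric]
    by (intro Bochner_Integration.integral_add cost_integrable int assms)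
  finally show ?thesis .
qed

lemma cost_diff_left:
  assumes \<pi>: "\<pi> \<in> couplings X Y" and "u \<in> K_tau X" "w \<in> K_tau X" "v \<in> K_tau Y"
  shows "cost \<pi> w v \<le> cost \<pi> u v + (\<integral>x. \<bar>u x - w x\<bar> \<partial>prob_meas X)"
proof -
  interpret \<pi>: prob_space \<pi> using \<pi> by (simp add: coupling_iff)
  have m: "(\<lambda>x. \<bar>u x - w x\<bar>) \<in> borel_measurable (prob_meas X)"
    using X.K_tau_measurable assms by (intro borel_measurable_abs borel_measurable_diff) auto
  have int: "integrable \<pi> (\<lambda>p. \<bar>u (fst p) - w (fst p)\<bar>)"
    using measurable_compose[OF coupling_measurable(1)[OF \<pi>] m]
    by (intro \<pi>.integrable_const_bound[where B=1])
       (auto simp: coupling_space[OF \<pi>] intro!: X.K_tau_diff_bound assms)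
  have "cost \<pi> w v \<le> (\<integral>p. \<bar>u (fst p) - v (snd p)\<bar> + \<bar>u (fst p) - w (fst p)\<bar> \<partial>\<pi>)"
    unfolding cost_def
    by (intro integral_mono Bochner_Integration.integrable_add cost_integrable int assms) linarith
  also have "\<dots> = cost \<pi> u v + (\<integral>x. \<bar>u x - w x\<bar> \<partial>prob_meas X)"
    unfolding cost_def coupling_integral_fst[OF \<pi> m, symmetric]
    by (intro Bochner_Integration.integral_add cost_integrable int assms)
  finally show ?thesis .
qed

text \<open>Both functions are rounded down to multiples of \<open>c\<close>, each with error at
  most \<open>c\<close>. The rounded cost is a finite combination of measures of rectangles that are
  chosen independently of the coupling.\<close>

lemma cost_discretization:
  fixes c :: real
  assumes u: "u \<in> K_tau X" and v: "v \<in> K_tau Y" and "0 < c"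
  shows "\<exists>(I :: (int \<times> int) set) A B. finite I \<and>
    (\<forall>i. A i \<in> sets (prob_meas X)) \<and> (\<forall>i. B i \<in> sets (prob_meas Y)) \<and>
    (\<forall>\<pi>\<in>couplings X Y.
       \<bar>cost \<pi> u v - (\<Sum>(i, j)\<in>I. c * real_of_int \<bar>i - j\<bar> * measure \<pi> (A i \<times> B j))\<bar> \<le> 2 * c)"
proof -
  define r where "r = \<lceil>1 / c\<rceil>"
  define I where "I = {-r..r} \<times> {-r..r}"
  define A where "A i = {x \<in> space (prob_meas X). \<lfloor>u x / c\<rfloor> = i}" for i
  define B where "B i = {y \<in> space (prob_meas Y). \<lfloor>v y / c\<rfloor> = i}" for i
  note [measurable] = X.K_tau_measurable[OF u] Y.K_tau_measurable[OF v]
  have A: "A i \<in> sets (prob_meas X)" and B: "B i \<in> sets (prob_meas Y)" for i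
    unfolding A_def B_def by measurable
  have range: "\<lfloor>t / c\<rfloor> \<in> {-r..r}" if "\<bar>t\<bar> \<le> 1/2" for t
  proof -
    have "\<bar>t / c\<bar> \<le> 1 / c"
      using that \<open>0 < c\<close> by (simp add: divide_right_mono)
    then have "-(1/c) \<le> t / c" "t / c \<le> 1 / c"
      by linarith+
    then have "-r \<le> \<lfloor>t / c\<rfloor>" "\<lfloor>t / c\<rfloor> \<le> r"
      unfolding r_def by linarith+
    then show ?thesis by simp
  qed
  have "\<bar>cost \<pi> u v - (\<Sum>(i, j)\<in>I. c * real_of_int \<bar>i - j\<bar> * measure \<pi> (A i \<times> B j))\<bar> \<le> 2 * c"
    if \<pi>: "\<pi> \<in> couplings X Y" for \<pi>
  proof -
    interpret \<pi>: prob_space \<pi> using \<pi> by (simp add: coupling_iff)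
    have AB [measurable]: "A i \<times> B j \<in> sets \<pi>" for i j
      using A B by (simp add: coupling_sets[OF \<pi>])
    \<comment> \<open>The rounded integrand: the level sets are disjoint, so only the term of the
      rectangle containing \<open>p\<close> survives.\<close>
    define s where "s p = (\<Sum>k\<in>I. c * real_of_int \<bar>fst k - snd k\<bar> * indicator (A (fst k) \<times> B (snd k)) p)" for p
    have s_eq: "s p = c * real_of_int \<bar>\<lfloor>u (fst p) / c\<rfloor> - \<lfloor>v (snd p) / c\<rfloor>\<bar>" if p: "p \<in> space \<pi>" for p
    proof -
      define k0 where "k0 = (\<lfloor>u (fst p) / c\<rfloor>, \<lfloor>v (snd p) / c\<rfloor>)"
      have p': "fst p \<in> points X" "snd p \<in> points Y"
        using p by (auto simp: coupling_space[OF \<pi>])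
      then have "k0 \<in> I"
        using range X.K_tau_bound[OF u] Y.K_tau_bound[OF v] by (simp add: I_def k0_def)
      have "s p = (\<Sum>k\<in>I. if k = k0 then c * real_of_int \<bar>fst k - snd k\<bar> else 0)"
        unfolding s_def using p'
        by (intro sum.cong) (auto simp: A_def B_def k0_def indicator_def mem_Times_iff)
      also have "\<dots> = c * real_of_int \<bar>fst k0 - snd k0\<bar>"
        using \<open>k0 \<in> I\<close> by (subst sum.delta) (auto simp: I_def)
      finally show ?thesis by (simp add: k0_def)
    qed
    have int_s: "integrable \<pi> s"
      unfolding s_def by (intro Bochner_Integration.integrable_sum integrable_mult_right)
        (auto simp: \<pi>.emeasure_eq_measure)
    have "(\<integral>p. s p \<partial>\<pi>) = (\<Sum>k\<in>I. c * real_of_int \<bar>fst k - snd k\<bar> * measure \<pi> (A (fst k) \<times> B (snd k)))"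
      unfolding s_def
      by (subst Bochner_Integration.integral_sum)
         (auto simp: \<pi>.emeasure_eq_measure intro!: sum.cong arg_cong2[where f="(*)"] arg_cong[where f="measure \<pi>"]
           dest: sets.sets_into_space[OF AB, THEN subsetD])
    then have sum: "(\<Sum>(i, j)\<in>I. c * real_of_int \<bar>i - j\<bar> * measure \<pi> (A i \<times> B j)) = (\<integral>p. s p \<partial>\<pi>)"
      by (simp add: case_prod_beta)
    have "\<bar>\<bar>u (fst p) - v (snd p)\<bar> - s p\<bar> \<le> 2 * c" if "p \<in> space \<pi>" for p
    proof -
      have *: "\<bar>t - c * \<lfloor>t / c\<rfloor>\<bar> \<le> c" for t :: real
      proof -
        have "0 \<le> t / c - \<lfloor>t / c\<rfloor>" "t / c - \<lfloor>t / c\<rfloor> \<le> 1"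
          by linarith+
        then have "0 \<le> c * (t / c - \<lfloor>t / c\<rfloor>)" "c * (t / c - \<lfloor>t / c\<rfloor>) \<le> c * 1"
          using \<open>0 < c\<close> by (auto intro: mult_left_mono)
        then show ?thesis
          using \<open>0 < c\<close> by (simp add: right_diff_distrib)
      qed
      have "s p = \<bar>c * \<lfloor>u (fst p) / c\<rfloor> - c * \<lfloor>v (snd p) / c\<rfloor>\<bar>"
        using \<open>0 < c\<close> by (simp add: s_eq[OF that] abs_mult flip: right_diff_distrib)
      then show ?thesis
        using *[of "u (fst p)"] *[of "v (snd p)"] by linarith
    qed
    then have "(\<integral>p. \<bar>\<bar>u (fst p) - v (snd p)\<bar> - s p\<bar> \<partial>\<pi>) \<le> (\<integral>p. 2 * c \<partial>\<pi>)"
      by (intro integral_mono integrable_abs Bochner_Integration.integrable_diff int_s cost_integrable[OF \<pi> u v]) auto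
    moreover have "\<bar>cost \<pi> u v - (\<integral>p. s p \<partial>\<pi>)\<bar> \<le> (\<integral>p. \<bar>\<bar>u (fst p) - v (snd p)\<bar> - s p\<bar> \<partial>\<pi>)"
      unfolding cost_def
      by (subst Bochner_Integration.integral_diff[symmetric, OF cost_integrable[OF \<pi> u v] int_s])
         (rule integral_abs_bound)
    ultimately show ?thesis
      unfolding sum by (simp add: \<pi>.prob_space)
  qed
  moreover have "finite I"
    by (simp add: I_def)
  ultimately show ?thesis
    using A B by (intro exI[of _ I] exI[of _ A] exI[of _ B]) auto
qed

text \<open>Convergence on rectangles suffices because the discretization error is uniform over
  couplings.\<close>

lemma cost_tendsto:
  assumes \<pi>: "\<And>n. \<pi> n \<in> couplings X Y" and \<rho>: "\<rho> \<in> couplings X Y"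
    and lim: "\<And>A B. \<lbrakk>A \<in> sets (prob_meas X); B \<in> sets (prob_meas Y)\<rbrakk> \<Longrightarrow>
      ((\<lambda>n. measure (\<pi> n) (A \<times> B)) \<longlongrightarrow> measure \<rho> (A \<times> B)) G"
    and uv: "u \<in> K_tau X" "v \<in> K_tau Y"
  shows "((\<lambda>n. cost (\<pi> n) u v) \<longlongrightarrow> cost \<rho> u v) G"
proof (rule tendstoI)
  fix e :: real assume "0 < e"
  \<comment> \<open>With grid width \<open>e/8\<close> the two discretization errors are at most
    \<open>e/4\<close> each, leaving \<open>e/2\<close> for the finite sums.\<close>
  then have "0 < e/8" by simp
  then obtain I :: "(int \<times> int) set" and A B where "finite I"
    and AB: "\<forall>i. A i \<in> sets (prob_meas X)" "\<forall>i. B i \<in> sets (prob_meas Y)"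
    and le: "\<forall>\<pi>\<in>couplings X Y.
       \<bar>cost \<pi> u v - (\<Sum>(i, j)\<in>I. e/8 * real_of_int \<bar>i - j\<bar> * measure \<pi> (A i \<times> B j))\<bar> \<le> 2 * (e/8)"
    using cost_discretization[OF uv, of "e/8"] by blast
  define R where "R \<pi> = (\<Sum>(i, j)\<in>I. e/8 * real_of_int \<bar>i - j\<bar> * measure \<pi> (A i \<times> B j))" for \<pi> :: "('a \<times> 'b) measure"
  have "((\<lambda>n. R (\<pi> n)) \<longlongrightarrow> R \<rho>) G"
    unfolding R_def case_prod_beta using AB by (intro tendsto_sum tendsto_mult tendsto_const lim) auto
  then have "eventually (\<lambda>n. dist (R (\<pi> n)) (R \<rho>) < e/2) G"
    using \<open>0 < e\<close> by (intro tendstoD) auto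
  then show "eventually (\<lambda>n. dist (cost (\<pi> n) u v) (cost \<rho> u v) < e) G"
  proof eventually_elim
    case (elim n)
    have "\<bar>cost (\<pi> n) u v - R (\<pi> n)\<bar> \<le> 2 * (e/8)" "\<bar>cost \<rho> u v - R \<rho>\<bar> \<le> 2 * (e/8)"
      using le \<pi> \<rho> unfolding R_def by blast+
    with elim show ?case
      unfolding dist_real_def by linarith
  qed
qed

text \<open>This takes the place of Prokhorov's theorem, with convergence on all measurable
  rectangles. Extending the limit \<open>l\<close> from rectangles suffices, since they generate the
  sigma-algebra and the costs see nothing else.\<close>

lemma coupling_compactness:
  assumes \<pi>: "\<And>n :: nat. \<pi> n \<in> couplings X Y"
  shows "\<exists>\<rho>\<in>couplings X Y. \<exists>G. G \<noteq> bot \<and> G \<le> sequentially \<and>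
    (\<forall>A\<in>sets (prob_meas X). \<forall>B\<in>sets (prob_meas Y).
      ((\<lambda>n. measure (\<pi> n) (A \<times> B)) \<longlongrightarrow> measure \<rho> (A \<times> B)) G)"
proof -
  let ?M = "prob_meas X \<Otimes>\<^sub>M prob_meas Y"
  have prob: "prob_space (\<pi> n)" for n
    using \<pi> by (simp add: coupling_iff)
  obtain l G where G: "G \<noteq> bot" "G \<le> sequentially" and l: "\<And>C. ((\<lambda>n. measure (\<pi> n) C) \<longlongrightarrow> l C) G"
    using pointwise_cluster_filter[of "\<lambda>n. measure (\<pi> n)"] prob_space.prob_le_1[OF prob] by auto
  \<comment> \<open>Values common to all couplings of the sequence persist in the limit; this is how
    \<open>l\<close> gets the prescribed marginals.\<close>
  have l_eq: "l C = c" if "\<And>n. measure (\<pi> n) C = c" for C c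
    using tendsto_unique[OF G(1) l[of C], of c] that by simp
  interpret L: finitely_additive prod_top ?M l
  proof
    show "Hausdorff_space prod_top"
      by (simp add: Hausdorff_space_prod_topology X.met.Hausdorff_space_mtopology Y.met.Hausdorff_space_mtopology)
    show "space ?M = topspace prod_top"
      by (simp add: space_pair_measure)
    show "sets ?M = borel_sets prod_top"
      by (simp add: borel_sets_eq)
    show "0 \<le> l C" for C
      by (rule tendsto_lowerbound[OF l _ G(1)]) simp
    fix C D assume "C \<in> sets ?M" "D \<in> sets ?M" "C \<inter> D = {}"
    then have "measure (\<pi> n) (C \<union> D) = measure (\<pi> n) C + measure (\<pi> n) D" for n
      using finite_measure.finite_measure_Union[OF prob_space.finite_measure[OF prob[of n]], of C D]
      by (simp add: coupling_sets[OF \<pi>])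
    then have "((\<lambda>n. measure (\<pi> n) (C \<union> D)) \<longlongrightarrow> l C + l D) G"
      using tendsto_add[OF l[of C] l[of D]] by simp
    then show "l (C \<union> D) = l C + l D"
      using tendsto_unique[OF G(1) l[of "C \<union> D"]] by simp
  qed
  have l_fst: "l (A \<times> points Y) = measure (prob_meas X) A" if "A \<in> sets (prob_meas X)" for A
    by (rule l_eq) (rule coupling_measure_fst[OF \<pi> that])
  have l_snd: "l (points X \<times> B) = measure (prob_meas Y) B" if "B \<in> sets (prob_meas Y)" for B
    by (rule l_eq) (rule coupling_measure_snd[OF \<pi> that])
  have inner: "compact_inner prod_top l (A \<times> B)"
    if A: "A \<in> sets (prob_meas X)" and B: "B \<in> sets (prob_meas Y)" for A B
    unfolding compact_inner_def
  proof (intro allI impI)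
    fix e :: real assume "0 < e"
    obtain K where K: "compactin X.met.mtopology K" "K \<subseteq> A" "measure (prob_meas X) (A - K) < e/2"
      using X.compact_inner_regular[OF A, of "e/2"] \<open>0 < e\<close> by auto
    obtain L where L: "compactin Y.met.mtopology L" "L \<subseteq> B" "measure (prob_meas Y) (B - L) < e/2"
      using Y.compact_inner_regular[OF B, of "e/2"] \<open>0 < e\<close> by auto
    have KL: "K \<in> sets (prob_meas X)" "L \<in> sets (prob_meas Y)"
      using compactin_imp_closedin[OF X.met.Hausdorff_space_mtopology K(1)]
        compactin_imp_closedin[OF Y.met.Hausdorff_space_mtopology L(1)] by auto
    \<comment> \<open>The remainder is covered by two strips, on which \<open>l\<close> equals a
      marginal. Tightness of the marginals thus passes to \<open>l\<close>, although
      \<open>l\<close> is only finitely additive.\<close>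
    have "l (A \<times> B - K \<times> L) \<le> l ((A - K) \<times> points Y \<union> points X \<times> (B - L))"
      using A B KL sets.sets_into_space[OF A] sets.sets_into_space[OF B]
      by (intro L.mono) (auto intro!: sets.Un pair_measureI sets.Diff)
    also have "\<dots> \<le> l ((A - K) \<times> points Y) + l (points X \<times> (B - L))"
      using A B KL by (intro L.subadditive) (auto intro!: pair_measureI)
    also have "\<dots> < e"
      using A B KL K(3) L(3) by (simp add: l_fst l_snd)
    finally have "l (A \<times> B - K \<times> L) < e" .
    moreover have "compactin prod_top (K \<times> L)"
      using K L by (simp add: compactin_Times)
    ultimately show "\<exists>K. compactin prod_top K \<and> K \<subseteq> A \<times> B \<and> l (A \<times> B - K) < e"
      using K L by (intro exI[of _ "K \<times> L"]) auto
  qed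
  define R where "R = {A \<times> B | A B. A \<in> sets (prob_meas X) \<and> B \<in> sets (prob_meas Y)}"
  have "\<exists>\<rho>. sets \<rho> = sets ?M \<and> (\<forall>C\<in>R. emeasure \<rho> C = ennreal (l C))"
  proof (rule L.extension)
    show "R \<noteq> {}" "R \<subseteq> sets ?M"
      by (auto simp: R_def)
    show "sigma_sets (space ?M) R = sets ?M"
      by (simp add: sets_pair_measure space_pair_measure R_def)
    fix C assume "C \<in> R"
    then obtain A B where C: "C = A \<times> B" and A: "A \<in> sets (prob_meas X)" and B: "B \<in> sets (prob_meas Y)"
      by (auto simp: R_def)
    show "compact_inner prod_top l C"
      unfolding C using A B by (rule inner)
    \<comment> \<open>The complement of a rectangle is a union of two rectangles, so it is
      approximable as well.\<close>
    have "space ?M - C = (points X - A) \<times> points Y \<union> points X \<times> (points Y - B)"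
      by (auto simp: C space_pair_measure)
    also have "compact_inner prod_top l \<dots>"
      using A B by (intro L.compact_inner_Un inner) auto
    finally show "compact_inner prod_top l (space ?M - C)" .
  qed
  then obtain \<rho> where sets_\<rho>: "sets \<rho> = sets ?M"
    and "\<And>C. C \<in> R \<Longrightarrow> emeasure \<rho> C = ennreal (l C)"
    by auto
  then have rect: "emeasure \<rho> (A \<times> B) = ennreal (l (A \<times> B))"
    if "A \<in> sets (prob_meas X)" "B \<in> sets (prob_meas Y)" for A B
    using that by (auto simp: R_def)
  have space_\<rho>: "space \<rho> = points X \<times> points Y"
    using sets_eq_imp_space_eq[OF sets_\<rho>] by (simp add: space_pair_measure)
  have meas: "fst \<in> \<rho> \<rightarrow>\<^sub>M prob_meas X" "snd \<in> \<rho> \<rightarrow>\<^sub>M prob_meas Y"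
    unfolding measurable_cong_sets[OF sets_\<rho> refl] by auto
  have "distr \<rho> (prob_meas X) fst = prob_meas X"
  proof (rule measure_eqI)
    fix A assume "A \<in> sets (distr \<rho> (prob_meas X) fst)"
    then have A: "A \<in> sets (prob_meas X)" by simp
    have "fst -` A \<inter> space \<rho> = A \<times> points Y"
      using sets.sets_into_space[OF A] by (auto simp: space_\<rho>)
    then show "emeasure (distr \<rho> (prob_meas X) fst) A = emeasure (prob_meas X) A"
      using A by (simp add: emeasure_distr[OF meas(1)] rect l_fst X.prob.emeasure_eq_measure)
  qed simp
  moreover have "distr \<rho> (prob_meas Y) snd = prob_meas Y"
  proof (rule measure_eqI)
    fix B assume "B \<in> sets (distr \<rho> (prob_meas Y) snd)"
    then have B: "B \<in> sets (prob_meas Y)" by simp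
    have "snd -` B \<inter> space \<rho> = points X \<times> B"
      using sets.sets_into_space[OF B] by (auto simp: space_\<rho>)
    then show "emeasure (distr \<rho> (prob_meas Y) snd) B = emeasure (prob_meas Y) B"
      using B by (simp add: emeasure_distr[OF meas(2)] rect l_snd Y.prob.emeasure_eq_measure)
  qed simp
  moreover have "prob_space \<rho>"
    by (rule prob_space_distrD[OF meas(1)]) (simp add: calculation(1) X.prob.prob_space_axioms)
  ultimately have "\<rho> \<in> couplings X Y"
    using sets_\<rho> by (simp add: coupling_iff)
  moreover have "measure \<rho> (A \<times> B) = l (A \<times> B)"
    if "A \<in> sets (prob_meas X)" "B \<in> sets (prob_meas Y)" for A B
    using rect[OF that] L.nonneg by (simp add: measure_def)
  ultimately show ?thesis
    using G l by (intro bexI[of _ \<rho>] exI[of _ G]) auto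
qed

text \<open>For a fixed function, its near-optimal partner varies with the coupling. Moving the
  partner into a finite net allows one net element to be fixed in the limit, where the costs of the
  finitely many candidates converge.\<close>

lemma d_tau_attained: "\<exists>\<pi>\<in>couplings X Y. D_tau \<pi> X Y = d_tau X Y"
proof -
  have "\<forall>n :: nat. \<exists>\<pi>\<in>couplings X Y. D_tau \<pi> X Y < d_tau X Y + 1 / Suc n"
    using near_optimal_coupling by (metis less_add_same_cancel1 of_nat_0_less_iff zero_less_Suc zero_less_divide_1_iff)
  then obtain \<pi> where \<pi>: "\<And>n :: nat. \<pi> n \<in> couplings X Y" "\<And>n. D_tau (\<pi> n) X Y < d_tau X Y + 1 / Suc n"
    by metis
  obtain \<rho> G where \<rho>: "\<rho> \<in> couplings X Y" and G: "G \<noteq> bot" "G \<le> sequentially"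
    and lim: "\<And>A B. \<lbrakk>A \<in> sets (prob_meas X); B \<in> sets (prob_meas Y)\<rbrakk> \<Longrightarrow>
      ((\<lambda>n. measure (\<pi> n) (A \<times> B)) \<longlongrightarrow> measure \<rho> (A \<times> B)) G"
    using coupling_compactness[of \<pi>, OF \<pi>(1)] by blast
  note cost_lim = cost_tendsto[OF \<pi>(1) \<rho> lim]
  note approx = D_tau_le_iff[OF \<pi>(1), THEN iffD1, OF less_imp_le[OF \<pi>(2)]]
  \<comment> \<open>\<open>G\<close> is finer than the filter of tails, so whatever holds for all
    large \<open>n\<close> holds eventually along \<open>G\<close>.\<close>
  have small: "eventually (\<lambda>n. 1 / Suc n < e) G" if "0 < e" for e :: real
    using G(2) order_tendstoD(2)[OF LIMSEQ_Suc[OF lim_1_over_n] that] by (auto simp: le_filter_def)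
  have "D_tau \<rho> X Y \<le> d_tau X Y"
    unfolding D_tau_le_iff[OF \<rho>]
  proof (intro conjI ballI allI impI)
    fix u and e :: real assume u: "u \<in> K_tau X" and "0 < e"
    then have "0 < e/4" by simp
    obtain N where N: "N \<subseteq> K_tau Y" "finite N"
      "\<forall>v\<in>K_tau Y. \<exists>w\<in>N. (\<integral>y. \<bar>v y - w y\<bar> \<partial>prob_meas Y) < e/4"
      using Y.K_tau_totally_bounded[OF \<open>0 < e/4\<close>] by blast
    \<comment> \<open>A quarter of \<open>e\<close> each for near-optimality, for the slack in
      choosing \<open>v\<close>, and for the net; the last quarter makes the final inequality
      strict.\<close>
    have "eventually (\<lambda>n. \<exists>w\<in>N. cost (\<pi> n) u w < d_tau X Y + 3 * (e/4)) G"
      using small[OF \<open>0 < e/4\<close>]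
    proof eventually_elim
      case (elim n)
      obtain v where v: "v \<in> K_tau Y" "cost (\<pi> n) u v < d_tau X Y + 1 / Suc n + e/4"
        using approx[of n] u \<open>0 < e/4\<close> by blast
      then obtain w where w: "w \<in> N" "(\<integral>y. \<bar>v y - w y\<bar> \<partial>prob_meas Y) < e/4"
        using N(3) by blast
      have "cost (\<pi> n) u w < d_tau X Y + 3 * (e/4)"
        using cost_diff_right[OF \<pi>(1)[of n] u v(1), of w] w N(1) v(2) elim by force
      then show ?case
        using w(1) by blast
    qed
    then have "\<exists>w\<in>N. cost \<rho> u w \<le> d_tau X Y + 3 * (e/4)"
      using N(1) by (intro finite_net_limit[OF G(1) N(2), of "\<lambda>n. cost (\<pi> n) u"] cost_lim u) auto
    then show "\<exists>v\<in>K_tau Y. cost \<rho> u v < d_tau X Y + e"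
      using N(1) \<open>0 < e\<close> by force
  next
    fix v and e :: real assume v: "v \<in> K_tau Y" and "0 < e"
    then have "0 < e/4" by simp
    obtain N where N: "N \<subseteq> K_tau X" "finite N"
      "\<forall>u\<in>K_tau X. \<exists>w\<in>N. (\<integral>x. \<bar>u x - w x\<bar> \<partial>prob_meas X) < e/4"
      using X.K_tau_totally_bounded[OF \<open>0 < e/4\<close>] by blast
    have "eventually (\<lambda>n. \<exists>w\<in>N. cost (\<pi> n) w v < d_tau X Y + 3 * (e/4)) G"
      using small[OF \<open>0 < e/4\<close>]
    proof eventually_elim
      case (elim n)
      obtain u where u: "u \<in> K_tau X" "cost (\<pi> n) u v < d_tau X Y + 1 / Suc n + e/4"
        using approx[of n] v \<open>0 < e/4\<close> by blast
      then obtain w where w: "w \<in> N" "(\<integral>x. \<bar>u x - w x\<bar> \<partial>prob_meas X) < e/4"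
        using N(3) by blast
      have "cost (\<pi> n) w v < d_tau X Y + 3 * (e/4)"
        using cost_diff_left[OF \<pi>(1)[of n] u(1) _ v, of w] w N(1) u(2) elim by force
      then show ?case
        using w(1) by blast
    qed
    then have "\<exists>w\<in>N. cost \<rho> w v \<le> d_tau X Y + 3 * (e/4)"
      using N(1) by (intro finite_net_limit[OF G(1) N(2), of "\<lambda>n w. cost (\<pi> n) w v"] cost_lim v) auto
    then show "\<exists>u\<in>K_tau X. cost \<rho> u v < d_tau X Y + e"
      using N(1) \<open>0 < e\<close> by force
  qed
  then show ?thesis
    using \<rho> d_tau_le_D_tau[OF \<rho>] by (intro bexI[of _ \<rho>]) auto
qed

end

section \<open>Isomorphism\<close>

text \<open>Transport along \<open>S\<close> is required only approximately and on finite subsets,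
  the form in which pointwise closures absorb the error. It goes one way; the converse relation
  expresses the other.\<close>

definition matching :: "'a geom_data \<Rightarrow> 'b geom_data \<Rightarrow> ('a \<times> 'b) set \<Rightarrow> bool" where
  "matching X Y S \<longleftrightarrow> S \<subseteq> points X \<times> points Y \<and>
    (\<forall>u\<in>K_tau X. \<forall>e>0. \<forall>A. finite A \<longrightarrow> A \<subseteq> S \<longrightarrow> (\<exists>v\<in>K_tau Y. \<forall>p\<in>A. \<bar>u (fst p) - v (snd p)\<bar> < e))"

context data_pair
begin

text \<open>Distances are suprema over features. Through \<open>K_tau\<close>, a feature of
  \<open>X\<close> is nearly copied at two points by a feature of \<open>Y\<close>, and inverting
  \<open>tau\<close> locally turns this into closeness of the real values.\<close>

lemma matching_dist_le:
  assumes S: "matching X Y S" and xy: "(x, y) \<in> S" "(x', y') \<in> S"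
  shows "feature_dist X x x' \<le> feature_dist Y y y'"
proof (rule X.feature_dist_le)
  show pts: "x \<in> points X" "x' \<in> points X"
    using S xy by (auto simp: matching_def)
  have ptsY: "y \<in> points Y" "y' \<in> points Y"
    using S xy by (auto simp: matching_def)
  fix f assume f: "f \<in> features X"
  show "\<bar>f x - f x'\<bar> \<le> feature_dist Y y y'"
  proof (rule field_le_epsilon)
    fix e :: real assume "0 < e"
    then have "0 < e/2" by simp
    obtain c where c: "0 < c" "\<And>s. \<bar>tau s - tau (f x)\<bar> < c \<Longrightarrow> \<bar>s - f x\<bar> < e/2"
      using tau_inverse_continuous[OF \<open>0 < e/2\<close>] by metis
    obtain c' where c': "0 < c'" "\<And>s. \<bar>tau s - tau (f x')\<bar> < c' \<Longrightarrow> \<bar>s - f x'\<bar> < e/2"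
      using tau_inverse_continuous[OF \<open>0 < e/2\<close>] by metis
    \<comment> \<open>Half the smaller modulus: the passages from \<open>f\<close> to
      \<open>v\<close> and from \<open>v\<close> to \<open>g\<close> each cost less than
      \<open>b\<close>.\<close>
    define b where "b = min c c' / 2"
    have "0 < b"
      using c c' by (simp add: b_def)
    obtain v where v: "v \<in> K_tau Y"
        "\<forall>p\<in>{(x, y), (x', y')}. \<bar>compose (points X) tau f (fst p) - v (snd p)\<bar> < b"
      using S X.compose_tau_in_K_tau[OF f] \<open>0 < b\<close> xy unfolding matching_def
      by (metis empty_subsetI finite.emptyI finite.insertI insert_subset)
    obtain g where g: "g \<in> features Y" "\<forall>a\<in>{y, y'}. \<bar>v a - tau (g a)\<bar> < b"
      using Y.K_tau_approx[OF v(1), of "{y, y'}"] ptsY \<open>0 < b\<close> by auto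
    have "\<bar>tau (f x) - v y\<bar> < b" "\<bar>tau (f x') - v y'\<bar> < b"
      using v(2) pts by (auto simp: compose_def)
    moreover have "\<bar>v y - tau (g y)\<bar> < b" "\<bar>v y' - tau (g y')\<bar> < b"
      using g(2) by auto
    ultimately have "\<bar>tau (g y) - tau (f x)\<bar> < c" "\<bar>tau (g y') - tau (f x')\<bar> < c'"
      unfolding b_def by linarith+
    then have "\<bar>g y - f x\<bar> < e/2" "\<bar>g y' - f x'\<bar> < e/2"
      using c(2) c'(2) by auto
    then show "\<bar>f x - f x'\<bar> \<le> feature_dist Y y y' + e"
      using Y.feature_diff_le[OF g(1) ptsY] by linarith
  qed
qed

text \<open>The argument runs in \<open>K_tau\<close>, where no local inversion is needed, and
  returns to real-valued functions by \<open>compose_tau_in_K_tau_iff\<close>.\<close>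

lemma matching_features_closure:
  assumes S: "matching X Y S" and \<psi>: "\<And>y. y \<in> points Y \<Longrightarrow> (\<psi> y, y) \<in> S"
    and f: "f \<in> features_closure X"
  shows "compose (points Y) f \<psi> \<in> features_closure Y"
proof -
  let ?g = "compose (points Y) f \<psi>"
  have \<psi>X: "\<psi> y \<in> points X" if "y \<in> points Y" for y
    using \<psi>[OF that] S by (auto simp: matching_def)
  have fX: "compose (points X) tau f \<in> K_tau X"
    using f X.compose_tau_in_K_tau_iff X.features_closure_iff by blast
  have "compose (points Y) tau ?g \<in> K_tau Y"
    unfolding Y.K_tau_iff
  proof (intro conjI allI impI)
    show "compose (points Y) tau ?g \<in> points Y \<rightarrow>\<^sub>E UNIV"
      by (simp add: compose_def)
    fix A and e :: real assume A: "finite A" "A \<subseteq> points Y" and "0 < e"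
    then have "finite ((\<lambda>y. (\<psi> y, y)) ` A)" "(\<lambda>y. (\<psi> y, y)) ` A \<subseteq> S" "0 < e/2"
      using \<psi> by auto
    then obtain v where v: "v \<in> K_tau Y"
        "\<forall>p\<in>(\<lambda>y. (\<psi> y, y)) ` A. \<bar>compose (points X) tau f (fst p) - v (snd p)\<bar> < e/2"
      using S fX unfolding matching_def by meson
    obtain g where g: "g \<in> features Y" "\<forall>a\<in>A. \<bar>v a - tau (g a)\<bar> < e/2"
      using Y.K_tau_approx[OF v(1) A \<open>0 < e/2\<close>] by blast
    have "\<bar>compose (points Y) tau ?g a - tau (g a)\<bar> < e" if "a \<in> A" for a
    proof -
      have a: "a \<in> points Y" using A that by auto
      have "\<bar>tau (f (\<psi> a)) - v a\<bar> < e/2"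
        using v(2) that \<psi>X[OF a] by (auto simp: compose_def)
      moreover have "\<bar>v a - tau (g a)\<bar> < e/2"
        using g(2) that by blast
      moreover have "compose (points Y) tau ?g a = tau (f (\<psi> a))"
        using a by (simp add: compose_def)
      ultimately show ?thesis
        by linarith
    qed
    then show "\<exists>g\<in>features Y. \<forall>a\<in>A. \<bar>compose (points Y) tau ?g a - tau (g a)\<bar> < e"
      using g(1) by blast
  qed
  then show ?thesis
    by (subst (asm) Y.compose_tau_in_K_tau_iff) (auto simp: compose_def)
qed

text \<open>Approximate \<open>x\<close> by first coordinates of pairs in \<open>S\<close>. The
  second coordinates are then Cauchy, converge by completeness, and the limit pair lies in
  \<open>S\<close> by closedness.\<close>

lemma isometric_relation_total:
  assumes S: "S \<subseteq> points X \<times> points Y"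
    and iso: "\<And>x y x' y'. \<lbrakk>(x, y) \<in> S; (x', y') \<in> S\<rbrakk> \<Longrightarrow> feature_dist Y y y' \<le> feature_dist X x x'"
    and dense: "\<And>x e. \<lbrakk>x \<in> points X; 0 < e\<rbrakk> \<Longrightarrow> \<exists>p\<in>S. feature_dist X x (fst p) < e"
    and closed: "\<And>\<sigma> x y. \<lbrakk>\<And>n :: nat. \<sigma> n \<in> S; limitin X.met.mtopology (fst \<circ> \<sigma>) x sequentially;
       limitin Y.met.mtopology (snd \<circ> \<sigma>) y sequentially\<rbrakk> \<Longrightarrow> (x, y) \<in> S"
    and x: "x \<in> points X"
  shows "\<exists>y. (x, y) \<in> S"
proof -
  have "\<forall>n :: nat. \<exists>p\<in>S. feature_dist X x (fst p) < 1 / Suc n"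
    using dense[OF x] by simp
  then obtain \<sigma> where \<sigma>: "\<And>n :: nat. \<sigma> n \<in> S" "\<And>n. feature_dist X x (fst (\<sigma> n)) < 1 / Suc n"
    by metis
  have pts: "fst (\<sigma> n) \<in> points X" "snd (\<sigma> n) \<in> points Y" for n
    using \<sigma>(1)[of n] S by auto
  have small: "eventually (\<lambda>n. 1 / Suc n < e) sequentially" if "0 < e" for e :: real
    using order_tendstoD(2)[OF LIMSEQ_Suc[OF lim_1_over_n] that] .
  have lim: "limitin X.met.mtopology (fst \<circ> \<sigma>) x sequentially"
    unfolding X.met.limitin_metric
  proof (intro conjI allI impI x)
    fix e :: real assume "0 < e"
    then show "eventually (\<lambda>n. (fst \<circ> \<sigma>) n \<in> points X \<and> feature_dist X ((fst \<circ> \<sigma>) n) x < e) sequentially"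
      by (rule eventually_mono[OF small]) (use \<sigma>(2) pts in \<open>force simp: X.met.commute intro: less_trans\<close>)
  qed
  then have Cau: "X.met.MCauchy (fst \<circ> \<sigma>)"
    using pts by (intro X.met.convergent_imp_MCauchy) auto
  have "Y.met.MCauchy (snd \<circ> \<sigma>)"
    unfolding Y.met.MCauchy_def
  proof (intro conjI allI impI)
    show "range (snd \<circ> \<sigma>) \<subseteq> points Y"
      using pts by auto
    fix e :: real assume "0 < e"
    then obtain N where "\<forall>n n'. N \<le> n \<longrightarrow> N \<le> n' \<longrightarrow> feature_dist X ((fst \<circ> \<sigma>) n) ((fst \<circ> \<sigma>) n') < e"
      using Cau unfolding X.met.MCauchy_def by blast
    moreover have "feature_dist Y (snd (\<sigma> n)) (snd (\<sigma> n')) \<le> feature_dist X (fst (\<sigma> n)) (fst (\<sigma> n'))" for n n'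
      using iso[of "fst (\<sigma> n)" "snd (\<sigma> n)" "fst (\<sigma> n')" "snd (\<sigma> n')"] \<sigma>(1) by simp
    ultimately show "\<exists>N. \<forall>n n'. N \<le> n \<longrightarrow> N \<le> n' \<longrightarrow> feature_dist Y ((snd \<circ> \<sigma>) n) ((snd \<circ> \<sigma>) n') < e"
      by (metis comp_apply le_less_trans)
  qed
  then obtain y where "limitin Y.met.mtopology (snd \<circ> \<sigma>) y sequentially"
    using Y.mcomplete unfolding Y.met.mcomplete_def by blast
  then show ?thesis
    using closed[OF \<sigma>(1) lim] by blast
qed

text \<open>The topological support for the product topology, tested on open rectangles only, which
  form a base.\<close>

definition supp :: "('a \<times> 'b) measure \<Rightarrow> ('a \<times> 'b) set" where
  "supp \<pi> = {p \<in> points X \<times> points Y. \<forall>U V. openin X.met.mtopology U \<longrightarrow> openin Y.met.mtopology V \<longrightarrow>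
     fst p \<in> U \<longrightarrow> snd p \<in> V \<longrightarrow> 0 < measure \<pi> (U \<times> V)}"

context
  fixes \<pi> assumes \<pi>: "\<pi> \<in> couplings X Y"
begin

interpretation \<pi>: prob_space \<pi>
  using \<pi> by (simp add: coupling_iff)

lemma open_rectangle_sets: "openin X.met.mtopology U \<Longrightarrow> openin Y.met.mtopology V \<Longrightarrow> U \<times> V \<in> sets \<pi>"
  by (simp add: coupling_sets[OF \<pi>])

text \<open>Points outside the support lie in null rectangles of a countable base, whose union is
  null.\<close>

lemma AE_supp: "AE p in \<pi>. p \<in> supp \<pi>"
proof -
  obtain \<B> where B: "countable \<B>"
    "\<And>U V. (U, V) \<in> \<B> \<Longrightarrow> openin X.met.mtopology U \<and> openin Y.met.mtopology V"
    "\<And>W x y. \<lbrakk>openin (prod_topology X.met.mtopology Y.met.mtopology) W; (x, y) \<in> W\<rbrakk> \<Longrightarrow>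
       \<exists>U V. (U, V) \<in> \<B> \<and> x \<in> U \<and> y \<in> V \<and> U \<times> V \<subseteq> W"
    using second_countable_prod_base[OF X.second_countable Y.second_countable] by metis
  have "AE p in \<pi>. measure \<pi> (fst b \<times> snd b) = 0 \<longrightarrow> p \<notin> fst b \<times> snd b" if "b \<in> \<B>" for b
  proof (cases "measure \<pi> (fst b \<times> snd b) = 0")
    case True
    have "fst b \<times> snd b \<in> sets \<pi>"
      using B(2)[of "fst b" "snd b"] that by (simp add: open_rectangle_sets)
    then show ?thesis
      using True by (intro AE_I[of _ _ "fst b \<times> snd b"]) (auto simp: \<pi>.emeasure_eq_measure)
  qed simp
  then have "AE p in \<pi>. \<forall>b\<in>\<B>. measure \<pi> (fst b \<times> snd b) = 0 \<longrightarrow> p \<notin> fst b \<times> snd b"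
    using B(1) by (subst AE_ball_countable) auto
  then show ?thesis
    using AE_space
  proof eventually_elim
    case (elim p)
    show ?case
      unfolding supp_def
    proof (intro CollectI conjI allI impI)
      show "p \<in> points X \<times> points Y"
        using elim(2) by (simp add: coupling_space[OF \<pi>])
      fix U V assume UV: "openin X.met.mtopology U" "openin Y.met.mtopology V" "fst p \<in> U" "snd p \<in> V"
      then have "openin (prod_topology X.met.mtopology Y.met.mtopology) (U \<times> V)" "(fst p, snd p) \<in> U \<times> V"
        by (simp_all add: openin_prod_Times_iff mem_Times_iff)
      then obtain U' V' where *: "(U', V') \<in> \<B>" "fst p \<in> U'" "snd p \<in> V'" "U' \<times> V' \<subseteq> U \<times> V"
        using B(3)[of "U \<times> V" "fst p" "snd p"] by blast
      then have "measure \<pi> (U' \<times> V') \<noteq> 0"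
        using bspec[OF elim(1) *(1)] by (auto simp: mem_Times_iff)
      then have "0 < measure \<pi> (U' \<times> V')"
        by (simp add: zero_less_measure_iff)
      also have "\<dots> \<le> measure \<pi> (U \<times> V)"
        using * UV by (intro \<pi>.finite_measure_mono open_rectangle_sets)
      finally show "0 < measure \<pi> (U \<times> V)" .
    qed
  qed
qed

text \<open>Otherwise the strip over a ball about \<open>x\<close> would be null, contradicting full
  support of the first marginal.\<close>

lemma supp_dense_fst:
  assumes "x \<in> points X" "0 < e"
  shows "\<exists>p\<in>supp \<pi>. feature_dist X x (fst p) < e"
proof (rule ccontr)
  assume no: "\<not> ?thesis"
  let ?R = "X.met.mball x e \<times> points Y"
  have "AE p in \<pi>. p \<notin> ?R"
    using AE_supp by eventually_elim (use no in auto)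
  then have "measure \<pi> ?R = 0"
    using open_rectangle_sets[OF X.met.openin_mball Y.met.open_in_mspace]
    by (subst (asm) AE_iff_null_sets[symmetric]) (auto simp: null_sets_def measure_def)
  moreover have "0 < measure (prob_meas X) (X.met.mball x e)"
    using assms by (intro X.full_support[of _ x]) auto
  ultimately show False
    using coupling_measure_fst[OF \<pi> X.open_sets[OF X.met.openin_mball]] by simp
qed

lemma supp_dense_snd:
  assumes "y \<in> points Y" "0 < e"
  shows "\<exists>p\<in>supp \<pi>. feature_dist Y y (snd p) < e"
proof (rule ccontr)
  assume no: "\<not> ?thesis"
  let ?R = "points X \<times> Y.met.mball y e"
  have "AE p in \<pi>. p \<notin> ?R"
    using AE_supp by eventually_elim (use no in auto)
  then have "measure \<pi> ?R = 0"
    using open_rectangle_sets[OF X.met.open_in_mspace Y.met.openin_mball]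
    by (subst (asm) AE_iff_null_sets[symmetric]) (auto simp: null_sets_def measure_def)
  moreover have "0 < measure (prob_meas Y) (Y.met.mball y e)"
    using assms by (intro Y.full_support[of _ y]) auto
  ultimately show False
    using coupling_measure_snd[OF \<pi> Y.open_sets[OF Y.met.openin_mball]] by simp
qed

lemma supp_closed:
  assumes \<sigma>: "\<And>n :: nat. \<sigma> n \<in> supp \<pi>" and x: "limitin X.met.mtopology (fst \<circ> \<sigma>) x sequentially"
    and y: "limitin Y.met.mtopology (snd \<circ> \<sigma>) y sequentially"
  shows "(x, y) \<in> supp \<pi>"
  unfolding supp_def
proof (intro CollectI conjI allI impI)
  show "(x, y) \<in> points X \<times> points Y"
    using x y by (auto simp: limitin_def)
  fix U V assume UV: "openin X.met.mtopology U" "openin Y.met.mtopology V" "fst (x, y) \<in> U" "snd (x, y) \<in> V"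
  then have "eventually (\<lambda>n. fst (\<sigma> n) \<in> U) sequentially" "eventually (\<lambda>n. snd (\<sigma> n) \<in> V) sequentially"
    using x y by (auto simp: limitin_def)
  then have "eventually (\<lambda>n. fst (\<sigma> n) \<in> U \<and> snd (\<sigma> n) \<in> V) sequentially"
    by (rule eventually_conj)
  then obtain n where "fst (\<sigma> n) \<in> U" "snd (\<sigma> n) \<in> V"
    by (auto simp: eventually_sequentially)
  then show "0 < measure \<pi> (U \<times> V)"
    using \<sigma>[of n] UV unfolding supp_def by blast
qed

text \<open>A gap of \<open>e\<close> at a support point \<open>p\<close> persists as
  \<open>e/2\<close> on the product of balls of radius \<open>e/4\<close>, by the two Lipschitz
  bounds, so the cost is at least \<open>e/2\<close> times a positive mass. This threshold does not
  depend on \<open>u\<close> and \<open>v\<close>.\<close>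

lemma cost_controls_supp:
  assumes A: "finite A" "A \<subseteq> supp \<pi>" and "0 < e"
  shows "\<exists>c>0. \<forall>u\<in>K_tau X. \<forall>v\<in>K_tau Y. cost \<pi> u v < c \<longrightarrow> (\<forall>p\<in>A. \<bar>u (fst p) - v (snd p)\<bar> < e)"
proof -
  define R where "R p = X.met.mball (fst p) (e/4) \<times> Y.met.mball (snd p) (e/4)" for p
  have R: "R p \<in> sets \<pi>" for p
    unfolding R_def by (intro open_rectangle_sets) auto
  have pos: "0 < measure \<pi> (R p)" if "p \<in> A" for p
    using that A(2) \<open>0 < e\<close> unfolding supp_def R_def by (force simp: subset_eq)
  define c where "c = Min (insert 1 ((\<lambda>p. e/2 * measure \<pi> (R p)) ` A))"
  have "0 < c"
    using A(1) pos \<open>0 < e\<close> by (auto simp: c_def)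
  moreover have "\<bar>u (fst p) - v (snd p)\<bar> < e"
    if u: "u \<in> K_tau X" and v: "v \<in> K_tau Y" and cost: "cost \<pi> u v < c" and p: "p \<in> A" for u v p
  proof (rule ccontr)
    assume "\<not> \<bar>u (fst p) - v (snd p)\<bar> < e"
    then have far: "e \<le> \<bar>u (fst p) - v (snd p)\<bar>" by simp
    have le: "e/2 * indicator (R p) q \<le> \<bar>u (fst q) - v (snd q)\<bar>" if q: "q \<in> space \<pi>" for q
    proof (cases "q \<in> R p")
      case True
      then have "feature_dist X (fst p) (fst q) < e/4" "feature_dist Y (snd p) (snd q) < e/4"
        and "fst p \<in> points X" "fst q \<in> points X" "snd p \<in> points Y" "snd q \<in> points Y"
        by (auto simp: R_def)
      with X.K_tau_lipschitz[OF u, of "fst p" "fst q"] Y.K_tau_lipschitz[OF v, of "snd p" "snd q"] far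
      have "e/2 \<le> \<bar>u (fst q) - v (snd q)\<bar>"
        by linarith
      then show ?thesis
        using True by simp
    qed simp
    have "e/2 * measure \<pi> (R p) = (\<integral>q. e/2 * indicator (R p) q \<partial>\<pi>)"
      using R sets.sets_into_space[OF R[of p]] by (simp add: Int_absorb2)
    also have "\<dots> \<le> cost \<pi> u v"
      unfolding cost_def using R
      by (intro integral_mono cost_integrable \<pi> u v le) (auto simp: \<pi>.emeasure_eq_measure)
    also have "\<dots> < c" by (rule cost)
    also have "c \<le> e/2 * measure \<pi> (R p)"
      unfolding c_def using A(1) p by (intro Min_le) auto
    finally show False by simp
  qed
  ultimately show ?thesis
    by blast
qed

lemma supp_matching:
  assumes "D_tau \<pi> X Y \<le> 0"
  shows "matching X Y (supp \<pi>)" "matching Y X ((supp \<pi>)\<inverse>)"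
proof -
  have sub: "supp \<pi> \<subseteq> points X \<times> points Y"
    by (auto simp: supp_def)
  note D = assms[unfolded D_tau_le_iff[OF \<pi>]]
  show "matching X Y (supp \<pi>)"
    unfolding matching_def
  proof (intro conjI ballI allI impI sub)
    fix u A and e :: real assume u: "u \<in> K_tau X" and "0 < e" "finite A" "A \<subseteq> supp \<pi>"
    then obtain c where c: "0 < c" "\<forall>u\<in>K_tau X. \<forall>v\<in>K_tau Y. cost \<pi> u v < c \<longrightarrow>
        (\<forall>p\<in>A. \<bar>u (fst p) - v (snd p)\<bar> < e)"
      using cost_controls_supp by blast
    obtain v where "v \<in> K_tau Y" "cost \<pi> u v < 0 + c"
      using D u c(1) by blast
    then show "\<exists>v\<in>K_tau Y. \<forall>p\<in>A. \<bar>u (fst p) - v (snd p)\<bar> < e"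
      using c(2) u by (intro bexI[of _ v]) auto
  qed
  show "matching Y X ((supp \<pi>)\<inverse>)"
    unfolding matching_def
  proof (intro conjI ballI allI impI)
    show "(supp \<pi>)\<inverse> \<subseteq> points Y \<times> points X"
      using sub by auto
    fix v A and e :: real assume v: "v \<in> K_tau Y" and "0 < e" "finite A" "A \<subseteq> (supp \<pi>)\<inverse>"
    then have "finite (A\<inverse>)" "A\<inverse> \<subseteq> supp \<pi>"
      by auto
    then obtain c where c: "0 < c" "\<forall>u\<in>K_tau X. \<forall>v\<in>K_tau Y. cost \<pi> u v < c \<longrightarrow>
        (\<forall>p\<in>A\<inverse>. \<bar>u (fst p) - v (snd p)\<bar> < e)"
      using cost_controls_supp \<open>0 < e\<close> by blast
    obtain u where u: "u \<in> K_tau X" "cost \<pi> u v < 0 + c"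
      using D v c(1) by blast
    then have "\<forall>p\<in>A\<inverse>. \<bar>u (fst p) - v (snd p)\<bar> < e"
      using c(2) v by auto
    then have "\<forall>p\<in>A. \<bar>v (fst p) - u (snd p)\<bar> < e"
      by (force simp: abs_minus_commute)
    then show "\<exists>u\<in>K_tau X. \<forall>p\<in>A. \<bar>v (fst p) - u (snd p)\<bar> < e"
      using u(1) by blast
  qed
qed

end

end

text \<open>Matching in both directions makes the support an isometric relation, total on both
  sides, hence the graph of an isometry \<open>\<phi>\<close>. As \<open>\<pi>\<close> is
  concentrated on this graph, \<open>\<phi>\<close> carries one marginal to the other.\<close>

lemma zero_D_tau_imp_isomorphic:
  assumes "data_pair X Y" and \<pi>: "\<pi> \<in> couplings X Y" and D: "D_tau \<pi> X Y \<le> 0"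
  shows "isomorphic_data X Y"
proof -
  interpret XY: data_pair X Y by fact
  interpret YX: data_pair Y X ..
  interpret \<pi>: prob_space \<pi> using \<pi> by (simp add: XY.coupling_iff)
  define S where "S = XY.supp \<pi>"
  have S: "S \<subseteq> points X \<times> points Y"
    by (auto simp: S_def XY.supp_def)
  have m: "matching X Y S" "matching Y X (S\<inverse>)"
    using XY.supp_matching[OF \<pi> D] by (simp_all add: S_def)
  have le: "feature_dist X x x' \<le> feature_dist Y y y'" "feature_dist Y y y' \<le> feature_dist X x x'"
    if "(x, y) \<in> S" "(x', y') \<in> S" for x x' y y'
    using XY.matching_dist_le[OF m(1) that] YX.matching_dist_le[OF m(2), of y x y' x'] that by auto
  have "\<exists>y. (x, y) \<in> S" if "x \<in> points X" for x
    by (rule XY.isometric_relation_total[OF S le(2) _ _ that])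
       (auto simp: S_def intro: XY.supp_dense_fst[OF \<pi>] XY.supp_closed[OF \<pi>])
  then obtain \<phi> where \<phi>: "\<And>x. x \<in> points X \<Longrightarrow> (x, \<phi> x) \<in> S"
    by metis
  have "\<exists>x. (y, x) \<in> S\<inverse>" if "y \<in> points Y" for y
  proof (rule YX.isometric_relation_total[OF _ _ _ _ that])
    show "S\<inverse> \<subseteq> points Y \<times> points X"
      using S by auto
    show "feature_dist X x x' \<le> feature_dist Y y y'" if "(y, x) \<in> S\<inverse>" "(y', x') \<in> S\<inverse>" for x x' y y'
      using le(1) that by simp
    show "\<exists>p\<in>S\<inverse>. feature_dist Y y (fst p) < e" if y: "y \<in> points Y" "0 < e" for y e
    proof -
      obtain p where "p \<in> S" "feature_dist Y y (snd p) < e"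
        using XY.supp_dense_snd[OF \<pi> y] unfolding S_def by blast
      then show ?thesis
        by (intro bexI[of _ "(snd p, fst p)"]) auto
    qed
    fix \<sigma> y x assume \<sigma>: "\<And>n :: nat. \<sigma> n \<in> S\<inverse>"
      "limitin XY.Y.met.mtopology (fst \<circ> \<sigma>) y sequentially"
      "limitin XY.X.met.mtopology (snd \<circ> \<sigma>) x sequentially"
    have "(x, y) \<in> S"
      unfolding S_def
    proof (rule XY.supp_closed[OF \<pi>, of "prod.swap \<circ> \<sigma>"])
      show "(prod.swap \<circ> \<sigma>) n \<in> XY.supp \<pi>" for n
        using \<sigma>(1)[of n] by (auto simp: S_def prod.swap_def)
    qed (use \<sigma> in \<open>simp_all add: o_def\<close>)
    then show "(y, x) \<in> S\<inverse>" by simp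
  qed
  then obtain \<psi> where \<psi>: "\<And>y. y \<in> points Y \<Longrightarrow> (\<psi> y, y) \<in> S"
    by (metis converse_iff)
  have \<phi>Y: "\<phi> x \<in> points Y" if "x \<in> points X" for x
    using \<phi>[OF that] S by auto
  \<comment> \<open>Partners of the same point are at distance 0, so the support is a graph.\<close>
  have unique: "y = \<phi> x" if "(x, y) \<in> S" for x y
  proof -
    have x: "x \<in> points X" and y: "y \<in> points Y"
      using that S by auto
    have "feature_dist Y y (\<phi> x) \<le> 0"
      using le(2)[OF that \<phi>[OF x]] x by simp
    then show ?thesis
      using XY.Y.met.mdist_pos_less[of y "\<phi> x"] y \<phi>Y[OF x] by (meson not_le)
  qed
  have \<psi>\<phi>: "\<psi> (\<phi> x) = x" if "x \<in> points X" for x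
  proof -
    have "\<psi> (\<phi> x) \<in> points X"
      using \<psi>[OF \<phi>Y[OF that]] S by auto
    moreover have "feature_dist X (\<psi> (\<phi> x)) x \<le> 0"
      using le(1)[OF \<psi>[OF \<phi>Y[OF that]] \<phi>[OF that]] \<phi>Y[OF that] by simp
    ultimately show ?thesis
      using XY.X.met.mdist_pos_less[of "\<psi> (\<phi> x)" x] that by (meson not_le)
  qed
  have meas: "\<phi> \<in> prob_meas X \<rightarrow>\<^sub>M prob_meas Y"
  proof (rule measurable_continuous_map)
    show "continuous_map XY.X.met.mtopology XY.Y.met.mtopology \<phi>"
      unfolding XY.X.met.metric_continuous_map[OF XY.Y.met.Metric_space_axioms]
    proof (intro conjI ballI allI impI)
      fix a and e :: real assume a: "a \<in> points X" and "0 < e"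
      then show "\<exists>c>0. \<forall>x. x \<in> points X \<and> feature_dist X a x < c \<longrightarrow> feature_dist Y (\<phi> a) (\<phi> x) < e"
        using le(2)[OF \<phi>[OF a] \<phi>] le_less_trans by blast
    qed (use \<phi>Y in auto)
  qed (auto simp: XY.X.sets_eq XY.Y.sets_eq)
  have "distr (prob_meas X) (prob_meas Y) \<phi> = prob_meas Y"
  proof (rule measure_eqI)
    fix B assume "B \<in> sets (distr (prob_meas X) (prob_meas Y) \<phi>)"
    then have B: "B \<in> sets (prob_meas Y)" by simp
    let ?A = "\<phi> -` B \<inter> space (prob_meas X)"
    have A: "?A \<in> sets (prob_meas X)"
      by (rule measurable_sets[OF meas B])
    have "emeasure (distr (prob_meas X) (prob_meas Y) \<phi>) B = emeasure (prob_meas X) ?A"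
      by (rule emeasure_distr[OF meas B])
    \<comment> \<open>Lifting to \<open>\<pi>\<close> makes the two preimages comparable: they agree
      on the graph, up to a null set.\<close>
    also have "\<dots> = emeasure \<pi> (fst -` ?A \<inter> space \<pi>)"
      using emeasure_distr[OF XY.coupling_measurable(1)[OF \<pi>] A] XY.coupling_distr(1)[OF \<pi>] by simp
    also have "\<dots> = emeasure \<pi> (snd -` B \<inter> space \<pi>)"
    proof (rule emeasure_eq_AE)
      show "AE p in \<pi>. p \<in> fst -` ?A \<inter> space \<pi> \<longleftrightarrow> p \<in> snd -` B \<inter> space \<pi>"
        using XY.AE_supp[OF \<pi>]
      proof eventually_elim
        case (elim p)
        then have "snd p = \<phi> (fst p)" "fst p \<in> points X"
          using unique[of "fst p" "snd p"] S by (auto simp: S_def)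
        then show ?case by auto
      qed
    qed (rule measurable_sets[OF XY.coupling_measurable(1)[OF \<pi>] A]
          measurable_sets[OF XY.coupling_measurable(2)[OF \<pi>] B])+
    also have "\<dots> = emeasure (prob_meas Y) B"
      using emeasure_distr[OF XY.coupling_measurable(2)[OF \<pi>] B] XY.coupling_distr(2)[OF \<pi>] by simp
    finally show "emeasure (distr (prob_meas X) (prob_meas Y) \<phi>) B = emeasure (prob_meas Y) B" .
  qed simp
  moreover have "(\<lambda>g. compose (points X) g \<phi>) ` features_closure Y = features_closure X"
  proof (intro antisym subsetI)
    fix f assume "f \<in> (\<lambda>g. compose (points X) g \<phi>) ` features_closure Y"
    then show "f \<in> features_closure X"
      using YX.matching_features_closure[OF m(2), of \<phi>] \<phi> by auto
  next
    fix f assume f: "f \<in> features_closure X"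
    have "compose (points Y) f \<psi> \<in> features_closure Y"
      using XY.matching_features_closure[OF m(1) \<psi> f] by simp
    moreover have "f = compose (points X) (compose (points Y) f \<psi>) \<phi>"
    proof
      fix x show "f x = compose (points X) (compose (points Y) f \<psi>) \<phi> x"
        using f \<psi>\<phi>[of x] \<phi>Y[of x] by (cases "x \<in> points X") (auto simp: compose_def XY.X.features_closure_iff)
    qed
    ultimately show "f \<in> (\<lambda>g. compose (points X) g \<phi>) ` features_closure Y"
      by blast
  qed
  ultimately show ?thesis
    unfolding isomorphic_data_def using meas by blast
qed

text \<open>The coupling is the image of the first measure under
  \<open>x \<mapsto> (x, \<phi> x)\<close>, so costs become integrals over \<open>X\<close>. Members
  of \<open>K_tau\<close> are first approximated by features composed with \<open>tau\<close>, whose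
  partners come from the correspondence of closures.\<close>

lemma isomorphic_imp_zero_D_tau:
  assumes "data_pair X Y" and "isomorphic_data X Y"
  shows "\<exists>\<pi>\<in>couplings X Y. D_tau \<pi> X Y \<le> 0"
proof -
  interpret XY: data_pair X Y by fact
  obtain \<phi> where \<phi>: "\<phi> \<in> prob_meas X \<rightarrow>\<^sub>M prob_meas Y"
    and distr: "distr (prob_meas X) (prob_meas Y) \<phi> = prob_meas Y"
    and image: "(\<lambda>g. compose (points X) g \<phi>) ` features_closure Y = features_closure X"
    using assms(2) unfolding isomorphic_data_def by blast
  have \<phi>Y: "\<phi> x \<in> points Y" if "x \<in> points X" for x
    using measurable_space[OF \<phi>] that by simp
  define h where "h x = (x, \<phi> x)" for x
  have h: "h \<in> prob_meas X \<rightarrow>\<^sub>M prob_meas X \<Otimes>\<^sub>M prob_meas Y"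
    unfolding h_def using \<phi> by measurable
  define \<pi> where "\<pi> = distr (prob_meas X) (prob_meas X \<Otimes>\<^sub>M prob_meas Y) h"
  have "fst \<circ> h = (\<lambda>x. x)" "snd \<circ> h = \<phi>"
    by (auto simp: h_def)
  then have \<pi>: "\<pi> \<in> couplings X Y"
    unfolding XY.coupling_iff \<pi>_def
    by (auto simp: XY.X.prob.prob_space_distr[OF h] distr_distr[OF measurable_fst h]
        distr_distr[OF measurable_snd h] distr)
  have cost: "cost \<pi> u v = (\<integral>x. \<bar>u x - v (\<phi> x)\<bar> \<partial>prob_meas X)" if "u \<in> K_tau X" "v \<in> K_tau Y" for u v
  proof -
    have "(\<lambda>p. \<bar>u (fst p) - v (snd p)\<bar>) \<in> borel_measurable (prob_meas X \<Otimes>\<^sub>M prob_meas Y)"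
      using XY.cost_measurable[OF XY.product_coupling that] .
    from integral_distr[OF h this] show ?thesis
      by (simp add: cost_def \<pi>_def h_def)
  qed
  have K: "compose (points Y) tau g \<in> K_tau Y"
    "compose (points X) tau (compose (points X) g \<phi>) \<in> K_tau X" if "g \<in> features_closure Y" for g
  proof -
    show "compose (points Y) tau g \<in> K_tau Y"
      using that XY.Y.compose_tau_in_K_tau_iff XY.Y.features_closure_iff by blast
    have "compose (points X) g \<phi> \<in> features_closure X"
      using image that by blast
    then show "compose (points X) tau (compose (points X) g \<phi>) \<in> K_tau X"
      using XY.X.compose_tau_in_K_tau_iff XY.X.features_closure_iff by blast
  qed
  have "D_tau \<pi> X Y \<le> 0"
    unfolding XY.D_tau_le_iff[OF \<pi>]
  proof (intro conjI ballI allI impI)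
    fix u and e :: real assume u: "u \<in> K_tau X" and "0 < e"
    then obtain f where f: "f \<in> features X" "(\<integral>x. \<bar>u x - compose (points X) tau f x\<bar> \<partial>prob_meas X) < e"
      using XY.X.K_tau_L1_approx by metis
    then obtain g where g: "g \<in> features_closure Y" "f = compose (points X) g \<phi>"
      using XY.X.features_subset_closure image by blast
    have "cost \<pi> u (compose (points Y) tau g) = (\<integral>x. \<bar>u x - compose (points X) tau f x\<bar> \<partial>prob_meas X)"
      unfolding cost[OF u K(1)[OF g(1)]]
      by (intro Bochner_Integration.integral_cong) (auto simp: compose_def \<phi>Y g(2))
    then show "\<exists>v\<in>K_tau Y. cost \<pi> u v < 0 + e"
      using f(2) K(1)[OF g(1)] by (intro bexI[of _ "compose (points Y) tau g"]) auto
  next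
    fix v and e :: real assume v: "v \<in> K_tau Y" and "0 < e"
    then obtain g where g: "g \<in> features Y" "(\<integral>y. \<bar>v y - compose (points Y) tau g y\<bar> \<partial>prob_meas Y) < e"
      using XY.Y.K_tau_L1_approx by metis
    then have gc: "g \<in> features_closure Y"
      using XY.Y.features_subset_closure by blast
    let ?u = "compose (points X) tau (compose (points X) g \<phi>)"
    have "cost \<pi> ?u v = (\<integral>x. \<bar>v (\<phi> x) - compose (points Y) tau g (\<phi> x)\<bar> \<partial>prob_meas X)"
      unfolding cost[OF K(2)[OF gc] v]
      by (intro Bochner_Integration.integral_cong) (auto simp: compose_def \<phi>Y)
    also have "\<dots> = (\<integral>y. \<bar>v y - compose (points Y) tau g y\<bar> \<partial>distr (prob_meas X) (prob_meas Y) \<phi>)"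
      using XY.Y.K_tau_measurable[OF v] XY.Y.K_tau_measurable[OF K(1)[OF gc]]
      by (subst integral_distr[OF \<phi>]) auto
    finally show "\<exists>u\<in>K_tau X. cost \<pi> u v < 0 + e"
      using g(2) K(2)[OF gc] by (intro bexI[of _ ?u]) (auto simp: distr)
  qed
  then show ?thesis
    using \<pi> by blast
qed

section \<open>Isomorphism classes\<close>

lemma data_pairI: "\<lbrakk>geometric_data_set X; geometric_data_set Y\<rbrakk> \<Longrightarrow> data_pair X Y"
  by (simp add: data_pair_def data_set_def)

text \<open>Attainment turns distance 0 into one coupling with \<open>D_tau\<close> equal to 0,
  whose support defines the isomorphism.\<close>

lemma d_tau_eq_0_iff:
  assumes "data_pair X Y"
  shows "d_tau X Y = 0 \<longleftrightarrow> isomorphic_data X Y"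
proof -
  interpret XY: data_pair X Y by fact
  show ?thesis
  proof
    assume "d_tau X Y = 0"
    then show "isomorphic_data X Y"
      using XY.d_tau_attained zero_D_tau_imp_isomorphic[OF assms] by force
  next
    assume "isomorphic_data X Y"
    then obtain \<pi> where "\<pi> \<in> couplings X Y" "D_tau \<pi> X Y \<le> 0"
      using isomorphic_imp_zero_D_tau[OF assms] by blast
    then show "d_tau X Y = 0"
      using XY.d_tau_nonneg XY.d_tau_le_D_tau by force
  qed
qed

lemma isomorphic_data_refl:
  assumes "geometric_data_set X" shows "isomorphic_data X X"
proof -
  interpret data_set X using assms by unfold_locales
  have "compose (points X) g (\<lambda>x. x) = g" if "g \<in> features_closure X" for g
    using that by (intro ext) (auto simp: features_closure_iff compose_def PiE_def extensional_def)
  then have "(\<lambda>g. compose (points X) g (\<lambda>x. x)) ` features_closure X = features_closure X"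
    by (simp cong: image_cong)
  moreover have "distr (prob_meas X) (prob_meas X) (\<lambda>x. x) = prob_meas X"
    by simp
  ultimately show ?thesis
    unfolding isomorphic_data_def by (intro bexI[of _ "\<lambda>x. x"]) auto
qed

text \<open>Isomorphic data sets have distance 0, so triangle inequalities in both directions give
  equality.\<close>

lemma d_tau_isomorphic_cong:
  assumes "geometric_data_set X" "geometric_data_set X'" "geometric_data_set Y" "geometric_data_set Y'"
    and "isomorphic_data X X'" "isomorphic_data Y Y'"
  shows "d_tau X Y = d_tau X' Y'"
proof -
  have "d_tau X X' = 0" "d_tau Y Y' = 0" "d_tau X' X = 0" "d_tau Y' Y = 0"
    using assms d_tau_eq_0_iff[of X X'] d_tau_eq_0_iff[of Y Y'] d_tau_commute[of X X'] d_tau_commute[of Y Y']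
    by (simp_all add: data_pairI)
  then show ?thesis
    using assms d_tau_triangle[of X X' Y] d_tau_triangle[of X' Y' Y] d_tau_triangle[of X' X Y']
      d_tau_triangle[of X Y Y'] by (simp add: data_pairI)
qed

text \<open>Symmetry would require inverting a Borel map; here symmetry and transitivity are read
  off from the corresponding properties of \<open>d_tau\<close>.\<close>

lemma equiv_iso_rel: "equiv (Collect geometric_data_set) (iso_rel :: ('a geom_data \<times> 'a geom_data) set)"
proof (rule equivI)
  show "refl_on (Collect geometric_data_set) (iso_rel :: ('a geom_data \<times> 'a geom_data) set)"
    by (auto simp: refl_on_def iso_rel_def isomorphic_data_refl)
  show "iso_rel \<subseteq> Collect geometric_data_set \<times> (Collect geometric_data_set :: 'a geom_data set)"
    by (auto simp: iso_rel_def)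
  show "sym (iso_rel :: ('a geom_data \<times> 'a geom_data) set)"
  proof (rule symI)
    fix X Y :: "'a geom_data" assume "(X, Y) \<in> iso_rel"
    then show "(Y, X) \<in> iso_rel"
      using d_tau_eq_0_iff[of X Y] d_tau_eq_0_iff[of Y X] d_tau_commute[of X Y]
      by (simp add: iso_rel_def data_pairI)
  qed
  show "trans (iso_rel :: ('a geom_data \<times> 'a geom_data) set)"
  proof (rule transI)
    fix X Y Z :: "'a geom_data" assume "(X, Y) \<in> iso_rel" "(Y, Z) \<in> iso_rel"
    then show "(X, Z) \<in> iso_rel"
      using d_tau_eq_0_iff[of X Y] d_tau_isomorphic_cong[of X X Y Z] d_tau_eq_0_iff[of X Z]
      by (simp add: iso_rel_def data_pairI isomorphic_data_refl)
  qed
qed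

text \<open>The representatives picked by \<open>SOME\<close> are isomorphic to the given ones, so
  the distance does not change.\<close>

lemma class_d_tau_eq:
  fixes X Y :: "'a geom_data"
  assumes X: "geometric_data_set X" and Y: "geometric_data_set Y"
  shows "class_d_tau (iso_rel `` {X}) (iso_rel `` {Y}) = d_tau X Y"
proof -
  have some: "(X, SOME X'. X' \<in> iso_rel `` {X}) \<in> iso_rel" if "geometric_data_set X" for X :: "'a geom_data"
  proof -
    have "X \<in> iso_rel `` {X}"
      using equiv_class_self[OF equiv_iso_rel] that by simp
    then have "(SOME X'. X' \<in> iso_rel `` {X}) \<in> iso_rel `` {X}"
      by (rule someI)
    then show ?thesis by simp
  qed
  have "class_d_tau (iso_rel `` {X}) (iso_rel `` {Y}) =
      d_tau (SOME X'. X' \<in> iso_rel `` {X}) (SOME Y'. Y' \<in> iso_rel `` {Y})"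
    using X Y by (simp add: class_d_tau_def data_classes_def quotientI)
  also have "\<dots> = d_tau X Y"
    using some[OF X] some[OF Y]
    by (intro d_tau_isomorphic_cong[symmetric]) (auto simp: iso_rel_def)
  finally show ?thesis .
qed

lemma Metric_space_class_d_tau: "Metric_space (data_classes :: 'a geom_data set set) class_d_tau"
proof -
  have rep: "\<exists>X. geometric_data_set X \<and> C = iso_rel `` {X}" if "C \<in> data_classes" for C :: "'a geom_data set"
    using that by (auto simp: data_classes_def elim!: quotientE)
  show ?thesis
  proof
    fix C D :: "'a geom_data set"
    show "0 \<le> class_d_tau C D"
    proof (cases "C \<in> data_classes \<and> D \<in> data_classes")
      case True
      then obtain X Y where "geometric_data_set X" "C = iso_rel `` {X}" "geometric_data_set Y" "D = iso_rel `` {Y}"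
        using rep by meson
      then show ?thesis
        by (simp add: class_d_tau_eq data_pair.d_tau_nonneg data_pairI)
    qed (auto simp: class_d_tau_def)
    show "class_d_tau C D = class_d_tau D C"
    proof (cases "C \<in> data_classes \<and> D \<in> data_classes")
      case True
      then obtain X Y where "geometric_data_set X" "C = iso_rel `` {X}" "geometric_data_set Y" "D = iso_rel `` {Y}"
        using rep by meson
      then show ?thesis
        by (simp add: class_d_tau_eq d_tau_commute[of X Y] data_pairI)
    qed (auto simp: class_d_tau_def)
  next
    fix C D :: "'a geom_data set" assume "C \<in> data_classes" "D \<in> data_classes"
    then obtain X Y where XY: "geometric_data_set X" "C = iso_rel `` {X}" "geometric_data_set Y" "D = iso_rel `` {Y}"
      using rep by meson
    then have "C = D \<longleftrightarrow> isomorphic_data X Y"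
      using eq_equiv_class_iff[OF equiv_iso_rel, of X Y] by (simp add: iso_rel_def)
    then show "class_d_tau C D = 0 \<longleftrightarrow> C = D"
      using XY by (simp add: class_d_tau_eq d_tau_eq_0_iff data_pairI)
  next
    fix C D E :: "'a geom_data set" assume "C \<in> data_classes" "D \<in> data_classes" "E \<in> data_classes"
    then obtain X Y Z where "geometric_data_set X" "C = iso_rel `` {X}" "geometric_data_set Y" "D = iso_rel `` {Y}"
       "geometric_data_set Z" "E = iso_rel `` {Z}"
      using rep by meson
    then show "class_d_tau C E \<le> class_d_tau C D + class_d_tau D E"
      by (simp add: class_d_tau_eq d_tau_triangle data_pairI)
  qed
qed

theorem theorem3p4:
  shows "Metric_space (data_classes :: 'a geom_data set set) class_d_tau
    \<and> equiv (Collect geometric_data_set) (iso_rel :: ('a geom_data \<times> 'a geom_data) set)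
    \<and> (\<forall>(X :: 'a geom_data) (Y :: 'a geom_data). geometric_data_set X \<longrightarrow> geometric_data_set Y \<longrightarrow>
          class_d_tau (iso_rel `` {X}) (iso_rel `` {Y}) = d_tau X Y)
    \<and> (\<forall>(X :: 'a geom_data) (Y :: 'b geom_data). geometric_data_set X \<longrightarrow> geometric_data_set Y \<longrightarrow>
          0 \<le> d_tau X Y \<and> (d_tau X Y = 0 \<longleftrightarrow> isomorphic_data X Y) \<and> d_tau X Y = d_tau Y X)
    \<and> (\<forall>(X :: 'a geom_data) (Y :: 'b geom_data) (Z :: 'c geom_data).
          geometric_data_set X \<longrightarrow> geometric_data_set Y \<longrightarrow> geometric_data_set Z \<longrightarrow>
          d_tau X Z \<le> d_tau X Y + d_tau Y Z)
    \<and> (\<forall>(X :: 'a geom_data) (Y :: 'b geom_data). geometric_data_set X \<longrightarrow> geometric_data_set Y \<longrightarrow>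
          (\<exists>\<pi>\<in>couplings X Y. D_tau \<pi> X Y = d_tau X Y))"
proof (intro conjI allI impI)
  fix X :: "'a geom_data" and Y :: "'b geom_data"
  assume XY: "geometric_data_set X" "geometric_data_set Y"
  interpret data_pair X Y
    using XY by (rule data_pairI)
  show "0 \<le> d_tau X Y"
    by (rule d_tau_nonneg)
  show "d_tau X Y = 0 \<longleftrightarrow> isomorphic_data X Y"
    by (rule d_tau_eq_0_iff) unfold_locales
  show "d_tau X Y = d_tau Y X"
    by (rule d_tau_commute) unfold_locales
  show "\<exists>\<pi>\<in>couplings X Y. D_tau \<pi> X Y = d_tau X Y"
    by (rule d_tau_attained)
next
  fix X :: "'a geom_data" and Y :: "'b geom_data" and Z :: "'c geom_data"
  assume "geometric_data_set X" "geometric_data_set Y" "geometric_data_set Z"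
  then show "d_tau X Z \<le> d_tau X Y + d_tau Y Z"
    by (intro d_tau_triangle data_pairI)
qed (auto intro: Metric_space_class_d_tau equiv_iso_rel class_d_tau_eq)

end
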